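(* Let $\Omega\subsetneq\mathbb C$ be a domain. For every $0<\alpha<e^{-1/2}$ there exists a constant $C_\alpha>0$ (depending only on $\alpha$) such that $\lambda_1(\Omega)\le C_\alpha\,\mathscr R_{L,\alpha}(\Omega)^{-2}$.
   Context: $\lambda_1(\Omega):=\inf\{\int_\Omega|\nabla\phi|^2/\int_\Omega|\phi|^2:\phi\in C_0^\infty(\Omega)\setminus\{0\}\}$ is the first Dirichlet eigenvalue of $-\Delta$. With $\Delta(z,s)=\{\zeta:|\zeta-z|<s\}$ and $\mathcal C_l$ the logarithmic capacity, $\mathscr R_{L,\alpha}(\Omega):=\sup\{r>0:\text{there is } z\in\Omega \text{ with } \mathcal C_l(\overline{\Delta(z,s)}\setminus\Omega)\le\alpha s\text{ for all }s\in(0,r)\}$. *)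

theory Defs
  imports "HOL-Analysis.Analysis" "HOL-Probability.Probability"
begin

definition dx :: "(complex \<Rightarrow> real) \<Rightarrow> complex \<Rightarrow> real" where
  "dx f z = frechet_derivative f (at z) 1"

definition dy :: "(complex \<Rightarrow> real) \<Rightarrow> complex \<Rightarrow> real" where
  "dy f z = frechet_derivative f (at z) \<i>"

text \<open>C-infinity: f lies in a class of everywhere differentiable functions that is closed
  under taking both partial derivatives (i.e. all iterated partial derivatives exist).\<close>
definition smooth_fun :: "(complex \<Rightarrow> real) \<Rightarrow> bool" where
  "smooth_fun f \<longleftrightarrow> (\<exists>F. f \<in> F \<and>
     (\<forall>g\<in>F. (\<forall>z. g differentiable (at z)) \<and> dx g \<in> F \<and> dy g \<in> F))"

definition tsupport :: "(complex \<Rightarrow> real) \<Rightarrow> complex set" where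
  "tsupport f = closure {z. f z \<noteq> 0}"

definition test_functions :: "complex set \<Rightarrow> (complex \<Rightarrow> real) set" where
  "test_functions \<Omega> = {\<phi>. smooth_fun \<phi> \<and> compact (tsupport \<phi>) \<and> tsupport \<phi> \<subseteq> \<Omega>}"

definition lambda1 :: "complex set \<Rightarrow> real" where
  "lambda1 \<Omega> = Inf {(\<integral>z. (dx \<phi> z)\<^sup>2 + (dy \<phi> z)\<^sup>2 \<partial>lborel) / (\<integral>z. (\<phi> z)\<^sup>2 \<partial>lborel)
                     | \<phi>. \<phi> \<in> test_functions \<Omega> \<and> (\<exists>z. \<phi> z \<noteq> 0)}"

text \<open>Logarithmic energy I(mu) = double integral of log(1/|z-w|), split into positive and
  negative parts (the kernel is +infinity on the diagonal).\<close>
definition log_kernel_pos :: "complex \<times> complex \<Rightarrow> ennreal" where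
  "log_kernel_pos p = (if fst p = snd p then \<infinity> else ennreal (max 0 (- ln (cmod (fst p - snd p)))))"

definition log_kernel_neg :: "complex \<times> complex \<Rightarrow> ennreal" where
  "log_kernel_neg p = ennreal (max 0 (ln (cmod (fst p - snd p))))"

definition log_energy :: "complex measure \<Rightarrow> ereal" where
  "log_energy \<mu> = enn2ereal (\<integral>\<^sup>+ p. log_kernel_pos p \<partial>(\<mu> \<Otimes>\<^sub>M \<mu>))
                 - enn2ereal (\<integral>\<^sup>+ p. log_kernel_neg p \<partial>(\<mu> \<Otimes>\<^sub>M \<mu>))"

definition robin_const :: "complex set \<Rightarrow> ereal" where
  "robin_const K = Inf {log_energy \<mu> | \<mu>. prob_space \<mu> \<and> sets \<mu> = sets borel \<and> emeasure \<mu> K = 1}"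

definition log_capacity :: "complex set \<Rightarrow> real" where
  "log_capacity K = (if robin_const K = \<infinity> then 0 else exp (- real_of_ereal (robin_const K)))"

definition cap_inradius :: "real \<Rightarrow> complex set \<Rightarrow> ereal" where
  "cap_inradius \<alpha> \<Omega> = Sup {ereal r | r. r > 0 \<and> (\<exists>z\<in>\<Omega>. \<forall>s. 0 < s \<and> s < r \<longrightarrow>
        log_capacity (cball z s - \<Omega>) \<le> \<alpha> * s)}"

end

theory Submission
  imports Defs
begin

text \<open>
  Fix \<open>\<alpha> < \<beta> < exp (-1/2)\<close> and put \<open>K = cball z s - \<Omega>\<close>, whose capacity is below \<open>\<beta> s\<close>. Then some monic
  polynomial \<open>q\<close> of degree \<open>n\<close> with zeros in the disc satisfies \<open>|q| < (\<beta> s) ^ n\<close> on \<open>K\<close>: otherwise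
  one chooses greedily a Leja sequence in \<open>K\<close>, and a weak limit of its empirical measures has energy
  at most \<open>- ln (\<beta> s)\<close>. Hence \<open>u = (1/n) ln |q| - ln (\<beta> s)\<close> is negative on \<open>K\<close>, harmonic off the zeros
  of \<open>q\<close>, and bounded above by \<open>ln (2/\<beta>)\<close> on the disc. Since the mean of \<open>ln |\<zeta> - w|\<close> over a disc of
  radius \<open>s\<close> is at least \<open>ln s - 1/2\<close>, the mean of \<open>u\<close> is at least \<open>- ln \<beta> - 1/2 > 0\<close>; this is
  where the threshold comes from. The test function is \<open>\<eta> v\<close> with a cut-off \<open>\<eta>\<close> of the disc and
  \<open>v = \<Psi>(u)\<close> for a convex increasing \<open>\<Psi>\<close> vanishing on the negative axis. As \<open>v\<close> is subharmonic,
  Caccioppoli's inequality bounds its energy by the integral of \<open>v\<^sup>2 |\<nabla>\<eta>|\<^sup>2\<close>, which is bounded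
  independently of \<open>s\<close> and \<open>n\<close>, while its square integral is at least a constant times \<open>s\<^sup>2\<close>.
\<close>

section \<open>Leja sequences and small polynomials\<close>

lemma binary_expansion:
  fixes x :: real
  assumes "0 \<le> x" "x < 1"
  obtains a :: "nat \<Rightarrow> nat" where "\<And>k. a k \<le> 1" "(\<lambda>k. real (a k) / 2 ^ Suc k) sums x"
proof -
  \<comment> \<open>\<open>a k\<close> is the last bit of the integer \<open>d (Suc k)\<close>, so
    the digit series telescopes to the limit of \<open>d k / 2 ^ k\<close>. Since
    \<open>x < 1\<close>, the integer part \<open>d 0\<close> is 0.\<close>
  define d where "d k = nat \<lfloor>2 ^ k * x\<rfloor>" for k
  define a where "a k = d (Suc k) - 2 * d k" for k
  have d: "real (d k) \<le> 2 ^ k * x" "2 ^ k * x < real (d k) + 1" for k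
    using assms(1) by (auto simp: d_def)
  have *: "2 * d k \<le> d (Suc k)" "d (Suc k) \<le> 2 * d k + 1" for k
    using d[of k] d[of "Suc k"] by (simp_all add: algebra_simps)
  have a1: "a k \<le> 1" for k
    using *[of k] by (simp add: a_def)
  have "real (a k) / 2 ^ Suc k = real (d (Suc k)) / 2 ^ Suc k - real (d k) / 2 ^ k" for k
    using *(1)[of k] by (simp add: a_def of_nat_diff field_simps)
  moreover have "(\<lambda>k. real (d k) / 2 ^ k) \<longlonglongrightarrow> x"
  proof (rule real_tendsto_sandwich)
    show "\<forall>\<^sub>F k in sequentially. x - (1 / 2) ^ k \<le> real (d k) / 2 ^ k"
    proof (intro always_eventually allI)
      fix k
      show "x - (1 / 2) ^ k \<le> real (d k) / 2 ^ k"
        using d(2)[of k] by (simp add: power_one_over le_divide_eq algebra_simps)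
    qed
    show "\<forall>\<^sub>F k in sequentially. real (d k) / 2 ^ k \<le> x"
      using d(1) by (intro always_eventually allI) (simp add: field_simps)
    have "(\<lambda>k. x - (1 / 2) ^ k) \<longlonglongrightarrow> x - 0"
      by (intro tendsto_diff tendsto_const LIMSEQ_realpow_zero) auto
    then show "(\<lambda>k. x - (1 / 2) ^ k) \<longlonglongrightarrow> x" by simp
  qed auto
  from telescope_sums[OF this] have "(\<lambda>k. real (d (Suc k)) / 2 ^ Suc k - real (d k) / 2 ^ k) sums (x - real (d 0))"
    by simp
  moreover have "d 0 = 0" using d[of 0] assms by simp
  ultimately show ?thesis by (intro that[of a] a1) simp
qed

text \<open>Schoenberg's space-filling curve: if \<open>t\<close> has ternary digits \<open>2 c\<^sub>k\<close> with \<open>c\<^sub>k\<close> in \<open>{0, 1}\<close>,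
  the wave at \<open>3\<^sup>k t\<close> recovers \<open>c\<^sub>k\<close>, so the two coordinates have arbitrary binary digits.\<close>

definition schoenberg_wave :: "real \<Rightarrow> real" where
  "schoenberg_wave t = max 0 (min 1 (1 / 2 - cos (pi * t)))"

definition schoenberg_coord :: "nat \<Rightarrow> real \<Rightarrow> real" where
  "schoenberg_coord i t = (\<Sum>k. schoenberg_wave (3 ^ (2 * k + i) * t) / 2 ^ Suc k)"

lemma continuous_schoenberg_coord: "continuous_on UNIV (schoenberg_coord i)"
proof -
  have "uniform_limit UNIV (\<lambda>n t. \<Sum>k<n. schoenberg_wave (3 ^ (2 * k + i) * t) / 2 ^ Suc k)
      (\<lambda>t. \<Sum>k. schoenberg_wave (3 ^ (2 * k + i) * t) / 2 ^ Suc k) sequentially"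
  proof (rule Weierstrass_m_test)
    show "norm (schoenberg_wave (3 ^ (2 * k + i) * t) / 2 ^ Suc k) \<le> (1 / 2) ^ Suc k" for k t
      by (simp add: schoenberg_wave_def power_divide divide_right_mono)
    show "summable (\<lambda>k. (1 / 2 :: real) ^ Suc k)"
      by (subst summable_Suc_iff) (simp add: summable_geometric)
  qed
  then have "continuous_on UNIV (\<lambda>t. \<Sum>k. schoenberg_wave (3 ^ (2 * k + i) * t) / 2 ^ Suc k)"
    by (rule uniform_limit_theorem[rotated])
      (auto simp: schoenberg_wave_def intro!: always_eventually continuous_intros)
  then show ?thesis
    unfolding schoenberg_coord_def .
qed

text \<open>After multiplication by \<open>3 ^ m\<close>, the digits before position
  \<open>m\<close> contribute an even integer \<open>2 * N\<close>, invisible to a wave of period 2;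
  digit \<open>m\<close> contributes 0 or 2/3, and the tail \<open>\<rho>\<close> lies in [0, 1/3].
  Modulo 2 the argument is therefore in [0, 1/3] or in [2/3, 1], where the clipped wave is
  constantly 0 or 1.\<close>

lemma schoenberg_wave_ternary:
  fixes c :: "nat \<Rightarrow> nat"
  assumes c: "\<And>k. c k \<le> 1"
  shows "schoenberg_wave (3 ^ m * (\<Sum>k. 2 * real (c k) / 3 ^ Suc k)) = real (c m)"
proof -
  let ?f = "\<lambda>k. 2 * real (c k) / 3 ^ Suc k"
  have c': "real (c k) \<le> 1" for k using c[of k] by simp
  have g: "(\<lambda>k. 2 / 3 ^ Suc (k + Suc m)) sums (1 / 3 ^ Suc m :: real)"
  proof -
    have "(\<lambda>k. (2 / 3 ^ Suc (Suc m)) * (1 / 3) ^ k) sums ((2 / 3 ^ Suc (Suc m)) * (1 / (1 - 1 / 3)) :: real)"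
      by (intro sums_mult geometric_sums) auto
    then show ?thesis by (simp add: field_simps power_add)
  qed
  have le: "?f (k + Suc m) \<le> 2 / 3 ^ Suc (k + Suc m)" for k
    using c'[of "k + Suc m"] by (intro divide_right_mono) auto
  have sm: "summable (\<lambda>k. ?f (k + Suc m))"
    by (rule summable_comparison_test'[OF sums_summable[OF g]]) (use le in auto)
  then have "summable ?f" by (rule summable_iff_shift[THEN iffD1])
  then have split: "suminf ?f = (\<Sum>k. ?f (k + Suc m)) + (\<Sum>k<Suc m. ?f k)"
    by (rule suminf_split_initial_segment)
  define \<rho> where "\<rho> = 3 ^ m * (\<Sum>k. ?f (k + Suc m))"
  have "0 \<le> (\<Sum>k. ?f (k + Suc m))" using sm by (intro suminf_nonneg) auto
  moreover have "(\<Sum>k. ?f (k + Suc m)) \<le> 1 / 3 ^ Suc m"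
    using suminf_le[OF le sm sums_summable[OF g]] sums_unique[OF g] by simp
  ultimately have \<rho>: "0 \<le> \<rho>" "\<rho> \<le> 1 / 3"
    by (auto simp: \<rho>_def field_simps)
  define N where "N = (\<Sum>k<m. c k * 3 ^ (m - Suc k))"
  have "3 ^ m * (\<Sum>k<m. ?f k) = 2 * real N"
    unfolding N_def of_nat_sum sum_distrib_left
  proof (rule sum.cong)
    fix k assume "k \<in> {..<m}"
    then have "(3::real) ^ m = 3 ^ (m - Suc k) * 3 ^ Suc k"
      by (metis Suc_leI lessThan_iff le_add_diff_inverse2 power_add)
    then show "3 ^ m * ?f k = 2 * real (c k * 3 ^ (m - Suc k))"
      by simp
  qed simp
  then have "3 ^ m * suminf ?f = 2 * real N + (2 / 3 * real (c m) + \<rho>)"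
    unfolding split \<rho>_def by (simp add: algebra_simps)
  moreover have "cos (pi * (2 * real N + u)) = cos (pi * u)" for u
    using cos_add[of "2 * real N * pi" "pi * u"] cos_2npi[of N] sin_2npi[of N]
    by (simp only: distrib_left mult_ac)
  ultimately have "schoenberg_wave (3 ^ m * suminf ?f) = schoenberg_wave (2 / 3 * real (c m) + \<rho>)"
    by (simp only: schoenberg_wave_def)
  also have "\<dots> = real (c m)"
  proof -
    consider "c m = 0" | "c m = 1" using c[of m] by linarith
    then show ?thesis
    proof cases
      case 1
      have "cos (pi / 3) \<le> cos (pi * \<rho>)"
        using \<rho> by (intro cos_monotone_0_pi_le) (auto simp: field_simps)
      then show ?thesis using 1 by (simp add: schoenberg_wave_def cos_60)
    next
      case 2
      have "pi * (2 / 3 + \<rho>) \<le> pi * 1"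
        using \<rho> by (intro mult_left_mono) auto
      then have "cos (pi * (2 / 3 + \<rho>)) \<le> cos (2 * pi / 3)"
        using \<rho> by (intro cos_monotone_0_pi_le) (auto simp: algebra_simps)
      also have "cos (2 * pi / 3) = - (1 / 2)"
        using cos_double_cos[of "pi / 3"] by (simp add: cos_60 power2_eq_square)
      finally show ?thesis using 2 by (simp add: schoenberg_wave_def)
    qed
  qed
  finally show ?thesis .
qed

lemma schoenberg_surj:
  assumes "0 \<le> x" "x < 1" "0 \<le> y" "y < 1"
  obtains t where "0 \<le> t" "t \<le> 1" "schoenberg_coord 0 t = x" "schoenberg_coord 1 t = y"
proof -
  obtain a where a: "\<And>k. a k \<le> 1" "(\<lambda>k. real (a k) / 2 ^ Suc k) sums x"
    using binary_expansion assms by blast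
  obtain b where b: "\<And>k. b k \<le> 1" "(\<lambda>k. real (b k) / 2 ^ Suc k) sums y"
    using binary_expansion assms by blast
  \<comment> \<open>Interleaving: coordinate 0 reads the even ternary positions and coordinate 1 the
    odd ones.\<close>
  define c where "c k = (if even k then a (k div 2) else b (k div 2))" for k
  have c: "c k \<le> 1" for k using a(1) b(1) by (simp add: c_def)
  define t where "t = (\<Sum>k. 2 * real (c k) / 3 ^ Suc k)"
  have g: "(\<lambda>k. 2 / 3 ^ Suc k) sums (1 :: real)"
  proof -
    have "(\<lambda>k. (2 / 3) * (1 / 3) ^ k) sums ((2 / 3) * (1 / (1 - 1 / 3)) :: real)"
      by (intro sums_mult geometric_sums) auto
    then show ?thesis by (simp add: field_simps)
  qed
  have le: "2 * real (c k) / 3 ^ Suc k \<le> 2 / 3 ^ Suc k" for k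
    using c[of k] by (intro divide_right_mono) auto
  have sm: "summable (\<lambda>k. 2 * real (c k) / 3 ^ Suc k)"
    by (rule summable_comparison_test'[OF sums_summable[OF g]]) (use le in auto)
  have "0 \<le> t" unfolding t_def using sm by (intro suminf_nonneg) auto
  moreover have "t \<le> 1"
    unfolding t_def using suminf_le[OF le sm sums_summable[OF g]] sums_unique[OF g] by simp
  moreover have "schoenberg_coord 0 t = x"
    using sums_unique[OF a(2)]
    unfolding schoenberg_coord_def t_def schoenberg_wave_ternary[OF c] by (simp add: c_def)
  moreover have "schoenberg_coord 1 t = y"
    using sums_unique[OF b(2)]
    unfolding schoenberg_coord_def t_def schoenberg_wave_ternary[OF c] by (simp add: c_def)
  ultimately show ?thesis using that by blast
qed

lemma bounded_curve_cover:
  fixes K :: "complex set"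
  assumes "bounded K"
  obtains G :: "real \<Rightarrow> complex" where "continuous_on UNIV G" "K \<subseteq> G ` {0..1}"
proof -
  obtain R where R: "R > 0" "\<And>z. z \<in> K \<Longrightarrow> cmod z < R"
    using bounded_pos_less[THEN iffD1, OF assms] by blast
  \<comment> \<open>The two coordinates reach every point of \<open>[0, 1) x [0, 1)\<close>. The
    strict bound by \<open>R\<close> keeps the rescaled coordinates of points of \<open>K\<close>
    below 1.\<close>
  define G where "G t = Complex (R * (2 * schoenberg_coord 0 t - 1)) (R * (2 * schoenberg_coord 1 t - 1))" for t
  have "continuous_on UNIV G"
    unfolding G_def Complex_eq
    by (intro continuous_intros continuous_on_of_real continuous_schoenberg_coord)
  moreover have "z \<in> G ` {0..1}" if "z \<in> K" for z
  proof -
    have "\<bar>Re z\<bar> < R" "\<bar>Im z\<bar> < R"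
      using R(2)[OF that] abs_Re_le_cmod[of z] abs_Im_le_cmod[of z] by linarith+
    then have *: "0 \<le> (Re z / R + 1) / 2" "(Re z / R + 1) / 2 < 1" "0 \<le> (Im z / R + 1) / 2" "(Im z / R + 1) / 2 < 1"
      using R(1) by (auto simp: field_simps)
    obtain t where "0 \<le> t" "t \<le> 1" and t: "schoenberg_coord 0 t = (Re z / R + 1) / 2"
        "schoenberg_coord 1 t = (Im z / R + 1) / 2"
      using schoenberg_surj[OF *] by blast
    moreover have "G t = z"
      unfolding G_def t using R(1) by (simp add: complex_eq_iff field_simps)
    ultimately show ?thesis by force
  qed
  ultimately show ?thesis using that by blast
qed

section \<open>Truncated logarithmic kernels and energies of limit measures\<close>

definition trunc_log :: "real \<Rightarrow> real \<Rightarrow> complex \<Rightarrow> complex \<Rightarrow> real" where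
  "trunc_log d M z w = - ln (max (exp (- M)) (min d (cmod (z - w))))"

text \<open>Clipping the distance at \<open>exp (- M)\<close> from below keeps the kernel finite on
  the diagonal. Capping it at \<open>d\<close> changes nothing on a set of diameter at most
  \<open>d\<close>, but bounds the kernel from below on the whole plane.\<close>

lemma
  assumes "1 \<le> d" "0 \<le> M"
  shows trunc_log_le: "trunc_log d M z w \<le> M"
    and trunc_log_ge: "- ln d \<le> trunc_log d M z w"
    and trunc_log_abs: "\<bar>trunc_log d M z w\<bar> \<le> M + ln d"
proof -
  let ?m = "max (exp (- M)) (min d (cmod (z - w)))"
  have "exp (- M) \<le> ?m" by simp
  then have "ln (exp (- M)) \<le> ln ?m"
    by (intro ln_mono) auto
  then show *: "trunc_log d M z w \<le> M" by (simp add: trunc_log_def)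
  have "exp (- M) \<le> 1" using assms by simp
  then have "?m \<le> d" using assms by (intro max.boundedI) linarith+
  then have "ln ?m \<le> ln d" using assms
    by (subst ln_le_cancel_iff) (auto simp: less_max_iff_disj)
  then show "- ln d \<le> trunc_log d M z w" by (simp add: trunc_log_def)
  with * show "\<bar>trunc_log d M z w\<bar> \<le> M + ln d"
    using assms ln_ge_zero[OF assms(1)] by linarith
qed

lemma trunc_log_sym: "trunc_log d M z w = trunc_log d M w z"
  by (simp add: trunc_log_def norm_minus_commute)

lemma trunc_log_le_kernel:
  assumes "z \<noteq> w" "cmod (z - w) \<le> d"
  shows "trunc_log d M z w \<le> - ln (cmod (z - w))"
  using assms ln_mono[of "cmod (z - w)" "max (exp (- M)) (cmod (z - w))"]
  by (simp add: trunc_log_def min_absorb2)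

lemma tendsto_trunc_log:
  assumes "(f \<longlongrightarrow> a) F" "(g \<longlongrightarrow> b) F"
  shows "((\<lambda>n. trunc_log d M (f n) (g n)) \<longlongrightarrow> trunc_log d M a b) F"
  unfolding trunc_log_def
  by (intro tendsto_minus tendsto_ln tendsto_max tendsto_min tendsto_norm tendsto_diff tendsto_const assms)
    (simp add: less_max_iff_disj less_imp_neq[symmetric])

lemma measurable_trunc_log [measurable]:
  assumes [measurable]: "f \<in> borel_measurable N" "g \<in> borel_measurable N"
  shows "(\<lambda>x. trunc_log d M (f x) (g x)) \<in> borel_measurable N"
  unfolding trunc_log_def by measurable

text \<open>Passing from \<open>N\<close> to \<open>N + 1\<close> adds one row, the equal column and
  one diagonal entry. The Leja condition says that the row sum is at most
  \<open>- (N + 1) * ln b\<close>, while the diagonal entry is at most \<open>M\<close>; so the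
  level \<open>M\<close> enters only linearly in \<open>N\<close>.\<close>

lemma trunc_log_leja_sum:
  fixes x :: "nat \<Rightarrow> complex"
  assumes b: "0 < b" and leja: "\<And>i. b ^ i \<le> (\<Prod>j<i. cmod (x i - x j))"
    and d: "1 \<le> d" "\<And>i j. cmod (x i - x j) \<le> d" and M: "0 \<le> M"
  shows "(\<Sum>i\<le>N. \<Sum>j\<le>N. trunc_log d M (x i) (x j)) \<le> (real N + 1) * M - ln b * (real N * (real N + 1))"
proof (induction N)
  case 0
  then show ?case using trunc_log_le[OF d(1) M] by simp
next
  case (Suc N)
  let ?k = "\<lambda>i j. trunc_log d M (x i) (x j)"
  have pos: "0 < (\<Prod>j<Suc N. cmod (x (Suc N) - x j))"
    using leja[of "Suc N"] b by (meson less_le_trans zero_less_power)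
  \<comment> \<open>A positive Leja product excludes repeated points, so the row stays off the
    diagonal and the true kernel dominates the truncated one.\<close>
  have ne: "x (Suc N) \<noteq> x j" if "j < Suc N" for j
  proof
    assume "x (Suc N) = x j"
    then have "(\<Prod>j<Suc N. cmod (x (Suc N) - x j)) = 0"
      using that by (intro prod_zero bexI[of _ j]) auto
    with pos show False by linarith
  qed
  have "(\<Sum>j\<le>N. ?k (Suc N) j) \<le> (\<Sum>j<Suc N. - ln (cmod (x (Suc N) - x j)))"
    unfolding lessThan_Suc_atMost
    by (intro sum_mono trunc_log_le_kernel d ne) auto
  also have "\<dots> = - ln (\<Prod>j<Suc N. cmod (x (Suc N) - x j))"
    using ne by (subst ln_prod) (auto simp: sum_negf)
  also have "\<dots> \<le> - ln (b ^ Suc N)"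
    using leja[of "Suc N"] b pos by (simp del: prod.lessThan_Suc)
  finally have row: "(\<Sum>j\<le>N. ?k (Suc N) j) \<le> - (real N + 1) * ln b"
    using ln_realpow[of b "Suc N"] by (simp add: algebra_simps del: power_Suc)
  have "(\<Sum>i\<le>N. ?k i (Suc N)) = (\<Sum>j\<le>N. ?k (Suc N) j)"
    by (intro sum.cong refl trunc_log_sym)
  then have "(\<Sum>i\<le>Suc N. \<Sum>j\<le>Suc N. ?k i j) = (\<Sum>i\<le>N. \<Sum>j\<le>N. ?k i j) + 2 * (\<Sum>j\<le>N. ?k (Suc N) j) + ?k (Suc N) (Suc N)"
    by (simp add: sum.distrib)
  also have "\<dots> \<le> ((real N + 1) * M - ln b * (real N * (real N + 1))) + 2 * (- (real N + 1) * ln b) + M"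
    using Suc row trunc_log_le[OF d(1) M] by (intro add_mono mult_left_mono) auto
  also have "\<dots> = (real (Suc N) + 1) * M - ln b * (real (Suc N) * (real (Suc N) + 1))"
    by (simp add: algebra_simps)
  finally show ?case .
qed

text \<open>Lifting the points along a space-filling curve reduces weak compactness in the plane to
  Helly selection and Skorohod representation on the line.\<close>

lemma empirical_limit:
  fixes x :: "nat \<Rightarrow> complex" and K :: "complex set"
  assumes K: "compact K" and x: "\<And>i. x i \<in> K"
  obtains \<Omega> :: "real measure" and r :: "nat \<Rightarrow> nat" and X :: "nat \<Rightarrow> real \<Rightarrow> complex" and Y :: "real \<Rightarrow> complex"
  where "prob_space \<Omega>" "strict_mono r"
    "\<And>n. X n \<in> borel_measurable \<Omega>" "Y \<in> borel_measurable \<Omega>"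
    "\<And>n (f :: complex \<Rightarrow> real). f \<in> borel_measurable borel \<Longrightarrow>
       (\<integral>\<omega>. f (X n \<omega>) \<partial>\<Omega>) = (\<Sum>i\<le>r n. f (x i)) / real (Suc (r n))"
    "\<And>n. AE \<omega> in \<Omega>. X n \<omega> \<in> K"
    "\<And>\<omega>. \<omega> \<in> space \<Omega> \<Longrightarrow> (\<lambda>n. X n \<omega>) \<longlonglongrightarrow> Y \<omega>"
proof -
  obtain G where G: "continuous_on UNIV G" "K \<subseteq> G ` {0..1::real}"
    using bounded_curve_cover[OF compact_imp_bounded[OF K]] by blast
  have Gm [measurable]: "G \<in> borel_measurable borel"
    using G(1) by (rule borel_measurable_continuous_onI)
  have [measurable]: "K \<in> sets borel" using K by (rule borel_compact)
  have "x i \<in> G ` {0..1}" for i using G(2) x by (rule subsetD)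
  then have "\<forall>i. \<exists>t. t \<in> {0..1} \<and> G t = x i" by (simp add: image_iff Bex_def eq_commute)
  then obtain T where T: "\<And>i. T i \<in> {0..1}" "\<And>i. G (T i) = x i" by metis
  define \<nu> where "\<nu> n = distr (measure_pmf (pmf_of_set {..n::nat})) borel T" for n
  have Tm: "T \<in> measurable (measure_pmf p) borel" for p by simp
  have \<nu>: "real_distribution (\<nu> n)" for n
    unfolding \<nu>_def by (intro real_distribution.intro measure_pmf.prob_space_distr Tm)
      (simp add: real_distribution_axioms_def)
  \<comment> \<open>\<open>tight\<close> asks for a half-open interval; starting at -1 instead of 0
    includes a possible parameter value 0.\<close>
  have "measure (\<nu> n) {-1<..1} = 1" for n
  proof -
    have "- 1 < T i" "T i \<le> 1" for i using T(1)[of i] by auto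
    then have "T -` {-1<..1} = UNIV" by auto
    then show ?thesis
      unfolding \<nu>_def by (subst measure_distr) auto
  qed
  then have "tight \<nu>"
    unfolding tight_def using \<nu> by (intro conjI allI impI exI[of _ "-1"] exI[of _ "1::real"]) auto
  from tight_imp_convergent_subsubsequence[OF this strict_mono_id]
  obtain r M where r: "strict_mono r" and M: "real_distribution M" and "weak_conv_m (\<nu> \<circ> id \<circ> r) M"
    by blast
  then have wc: "weak_conv_m (\<lambda>n. \<nu> (r n)) M" by (simp add: comp_def)
  obtain \<Omega> :: "real measure" and Y_seq Y where \<Omega>: "prob_space \<Omega>"
    and Ym [measurable]: "\<And>n. Y_seq n \<in> borel_measurable \<Omega>" "Y \<in> measurable \<Omega> lborel"
    and Yd: "\<And>n. distr \<Omega> borel (Y_seq n) = \<nu> (r n)"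
    and Yl: "\<And>\<omega>. \<omega> \<in> space \<Omega> \<Longrightarrow> (\<lambda>n. Y_seq n \<omega>) \<longlonglongrightarrow> Y \<omega>"
    using Skorohod[OF \<nu> M wc] by blast
  have Ym' [measurable]: "Y \<in> borel_measurable \<Omega>" using Ym(2) by simp
  show ?thesis
  proof (rule that[OF \<Omega> r, of "\<lambda>n \<omega>. G (Y_seq n \<omega>)" "\<lambda>\<omega>. G (Y \<omega>)"])
    show "(\<lambda>\<omega>. G (Y_seq n \<omega>)) \<in> borel_measurable \<Omega>" for n by measurable
    show "(\<lambda>\<omega>. G (Y \<omega>)) \<in> borel_measurable \<Omega>" by measurable
    show "(\<integral>\<omega>. f (G (Y_seq n \<omega>)) \<partial>\<Omega>) = (\<Sum>i\<le>r n. f (x i)) / real (Suc (r n))"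
      if [measurable]: "f \<in> borel_measurable borel" for n and f :: "complex \<Rightarrow> real"
    proof -
      have "(\<integral>\<omega>. f (G (Y_seq n \<omega>)) \<partial>\<Omega>) = (\<integral>t. f (G t) \<partial>\<nu> (r n))"
        unfolding Yd[symmetric] by (subst integral_distr) auto
      also have "\<dots> = (\<integral>i. f (x i) \<partial>measure_pmf (pmf_of_set {..r n}))"
        unfolding \<nu>_def by (subst integral_distr) (auto simp: T)
      also have "\<dots> = (\<Sum>i\<le>r n. f (x i)) / real (Suc (r n))"
        by (subst integral_pmf_of_set) auto
      finally show ?thesis .
    qed
    show "AE \<omega> in \<Omega>. G (Y_seq n \<omega>) \<in> K" for n
    proof -
      have "AE t in \<nu> (r n). G t \<in> K"
        unfolding \<nu>_def by (subst AE_distr_iff) (auto simp: T x)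
      then show ?thesis
        unfolding Yd[symmetric] by (subst (asm) AE_distr_iff) auto
    qed
    show "(\<lambda>n. G (Y_seq n \<omega>)) \<longlonglongrightarrow> G (Y \<omega>)" if "\<omega> \<in> space \<Omega>" for \<omega>
      using continuous_on_tendsto_compose[OF G(1) Yl[OF that]] by simp
  qed
qed

text \<open>On a set of diameter at most \<open>d\<close> the negative part of the energy is at most
  \<open>ln d\<close>. Hence the difference in \<open>log_energy\<close> is never infinity minus
  infinity.\<close>

lemma
  assumes "prob_space \<mu>" and sets: "sets \<mu> = sets borel" and K: "K \<in> sets borel" "AE z in \<mu>. z \<in> K"
    and d: "1 \<le> d" "\<forall>z\<in>K. \<forall>w\<in>K. cmod (z - w) \<le> d"
  shows AE_pair_measure_supported: "AE p in \<mu> \<Otimes>\<^sub>M \<mu>. fst p \<in> K \<and> snd p \<in> K"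
    and nn_integral_log_kernel_neg_le: "(\<integral>\<^sup>+p. log_kernel_neg p \<partial>(\<mu> \<Otimes>\<^sub>M \<mu>)) \<le> ennreal (ln d)"
proof -
  interpret \<mu>: prob_space \<mu> by fact
  interpret pair_prob_space \<mu> \<mu> ..
  show AE: "AE p in \<mu> \<Otimes>\<^sub>M \<mu>. fst p \<in> K \<and> snd p \<in> K"
  proof (rule AE_pair_measure)
    note [measurable] = K(1) and [measurable_cong] = sets
    show "{p \<in> space (\<mu> \<Otimes>\<^sub>M \<mu>). fst p \<in> K \<and> snd p \<in> K} \<in> sets (\<mu> \<Otimes>\<^sub>M \<mu>)"
      by measurable
    show "AE z in \<mu>. AE w in \<mu>. fst (z, w) \<in> K \<and> snd (z, w) \<in> K"
      using K(2)
    proof eventually_elim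
      case (elim z)
      show ?case using K(2) by eventually_elim (use elim in simp)
    qed
  qed
  have "(\<integral>\<^sup>+p. log_kernel_neg p \<partial>(\<mu> \<Otimes>\<^sub>M \<mu>)) \<le> (\<integral>\<^sup>+p. ennreal (ln d) \<partial>(\<mu> \<Otimes>\<^sub>M \<mu>))"
  proof (rule nn_integral_mono_AE)
    show "AE p in \<mu> \<Otimes>\<^sub>M \<mu>. log_kernel_neg p \<le> ennreal (ln d)"
      using AE
    proof eventually_elim
      case (elim p)
      show ?case
      proof (cases "fst p = snd p")
        case False
        then have "ln (cmod (fst p - snd p)) \<le> ln d"
          using elim d(2) by (intro ln_mono) auto
        then show ?thesis using d(1) by (auto simp: log_kernel_neg_def intro!: ennreal_leI)
      qed (simp add: log_kernel_neg_def)
    qed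
  qed
  also have "\<dots> = ennreal (ln d)"
    by (simp add: P.emeasure_space_1)
  finally show "(\<integral>\<^sup>+p. log_kernel_neg p \<partial>(\<mu> \<Otimes>\<^sub>M \<mu>)) \<le> ennreal (ln d)" .
qed

text \<open>The truncated kernels increase with \<open>M\<close> to the full kernel, so a bound
  common to all levels passes to the energy by monotone convergence.\<close>

lemma log_energy_le_truncated:
  assumes "prob_space \<mu>" and sets: "sets \<mu> = sets borel" and K: "K \<in> sets borel" "AE z in \<mu>. z \<in> K"
    and d: "1 \<le> d" "\<forall>z\<in>K. \<forall>w\<in>K. cmod (z - w) \<le> d"
    and V: "\<And>M. 0 \<le> M \<Longrightarrow> (\<integral>z. \<integral>w. trunc_log d M z w \<partial>\<mu> \<partial>\<mu>) \<le> V"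
  shows "log_energy \<mu> \<le> ereal V"
proof -
  interpret \<mu>: prob_space \<mu> by fact
  interpret pair_prob_space \<mu> \<mu> ..
  let ?P = "\<mu> \<Otimes>\<^sub>M \<mu>"
  note [measurable_cong] = sets
  note AE = AE_pair_measure_supported[OF \<mu>.prob_space_axioms sets K d]
  note neg = nn_integral_log_kernel_neg_le[OF \<mu>.prob_space_axioms sets K d]
  have ld: "0 \<le> ln d" using d(1) by simp
  \<comment> \<open>Adding \<open>ln d\<close> makes all truncations nonnegative, so that they can
    be handled as extended nonnegative functions.\<close>
  define k where "k n p = trunc_log d (real n) (fst p) (snd p) + ln d" for n p
  have km [measurable]: "k n \<in> borel_measurable ?P" for n
    unfolding k_def by measurable
  have k0: "0 \<le> k n p" for n p
    using trunc_log_ge[OF d(1), of "real n" "fst p" "snd p"] by (simp add: k_def)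
  have kint: "integrable ?P (k n)" "(\<integral>p. k n p \<partial>?P) \<le> V + ln d" for n
  proof -
    have int: "integrable ?P (\<lambda>p. trunc_log d (real n) (fst p) (snd p))"
      using trunc_log_abs[OF d(1), of "real n"] by (intro P.integrable_const_bound[where B = "real n + ln d"]) auto
    then show "integrable ?P (k n)" unfolding k_def by simp
    have "(\<integral>p. trunc_log d (real n) (fst p) (snd p) \<partial>?P) \<le> V"
      using V[of "real n"] integral_fst'[OF int] by simp
    then show "(\<integral>p. k n p \<partial>?P) \<le> V + ln d"
      using int by (simp add: k_def P.prob_space)
  qed
  have knn: "(\<integral>\<^sup>+p. ennreal (k n p) \<partial>?P) \<le> ennreal (V + ln d)" for n
    using kint[of n] k0 by (subst nn_integral_eq_integral) (auto intro: ennreal_leI)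
  have "incseq (\<lambda>n p. ennreal (k n p))"
  proof (intro incseq_SucI le_funI ennreal_leI)
    fix n p
    have "exp (- real (Suc n)) \<le> exp (- real n)" by simp
    then have "ln (max (exp (- real (Suc n))) (min d (cmod (fst p - snd p)))) \<le> ln (max (exp (- real n)) (min d (cmod (fst p - snd p))))"
      by (intro ln_mono max.mono) (auto simp: less_max_iff_disj)
    then show "k n p \<le> k (Suc n) p" by (simp add: k_def trunc_log_def)
  qed
  then have sup: "(\<integral>\<^sup>+p. (SUP n. ennreal (k n p)) \<partial>?P) \<le> ennreal (V + ln d)"
    using knn by (subst nn_integral_monotone_convergence_SUP) (auto intro: SUP_least)
  have [measurable]: "log_kernel_pos \<in> borel_measurable ?P" "log_kernel_neg \<in> borel_measurable ?P"
    unfolding log_kernel_pos_def log_kernel_neg_def by measurable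
  \<comment> \<open>The negative part is kept on the other side of the inequality; it is subtracted
    only after all integrals are known to be finite.\<close>
  have "(\<integral>\<^sup>+p. log_kernel_pos p \<partial>?P) + ennreal (ln d) = (\<integral>\<^sup>+p. log_kernel_pos p + ennreal (ln d) \<partial>?P)"
    by (subst nn_integral_add) (auto simp: P.emeasure_space_1)
  also have "\<dots> \<le> (\<integral>\<^sup>+p. (SUP n. ennreal (k n p)) + log_kernel_neg p \<partial>?P)"
  proof (rule nn_integral_mono_AE)
    show "AE p in ?P. log_kernel_pos p + ennreal (ln d) \<le> (SUP n. ennreal (k n p)) + log_kernel_neg p"
      using AE
    proof eventually_elim
      case (elim p)
      show ?case
      proof (cases "fst p = snd p")
        case True
        have "of_nat n \<le> (SUP n. ennreal (k n p))" for n
        proof -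
          have "real n \<le> k n p" using True d(1) ld by (simp add: k_def trunc_log_def min_def max_def)
          then have "ennreal (real n) \<le> ennreal (k n p)" by (rule ennreal_leI)
          also have "\<dots> \<le> (SUP n. ennreal (k n p))" by (rule SUP_upper) simp
          finally show ?thesis by (simp add: ennreal_of_nat_eq_real_of_nat)
        qed
        then have "(SUP n. of_nat n) \<le> (SUP n. ennreal (k n p))"
          by (intro SUP_least)
        then have top: "(SUP n. ennreal (k n p)) = \<top>"
          by (simp add: ennreal_SUP_of_nat_eq_top top_unique)
        show ?thesis unfolding top by simp
      next
        case False
        let ?c = "cmod (fst p - snd p)"
        have c: "0 < ?c" "?c \<le> d" using False elim d(2) by auto
        obtain n :: nat where "- ln ?c \<le> real n" using real_arch_simple by blast
        then have "exp (- real n) \<le> exp (ln ?c)" by (subst exp_le_cancel_iff) linarith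
        then have "exp (- real n) \<le> ?c" using c(1) by (simp only: exp_ln)
        then have "k n p = - ln ?c + ln d"
          using c by (simp add: k_def trunc_log_def min_absorb2 max_absorb2)
        moreover have "ennreal (k n p) \<le> (SUP n. ennreal (k n p))"
          by (rule SUP_upper) simp
        moreover have "ln ?c \<le> ln d" using c by (intro ln_mono) auto
        then have "log_kernel_pos p + ennreal (ln d) = ennreal (- ln ?c + ln d) + log_kernel_neg p"
          using False ld by (simp add: log_kernel_pos_def log_kernel_neg_def max_def flip: ennreal_plus)
        ultimately show ?thesis by (simp only: add_right_mono)
      qed
    qed
  qed
  also have "\<dots> = (\<integral>\<^sup>+p. (SUP n. ennreal (k n p)) \<partial>?P) + (\<integral>\<^sup>+p. log_kernel_neg p \<partial>?P)"
    by (intro nn_integral_add) auto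
  also have "\<dots> \<le> ennreal (V + ln d) + (\<integral>\<^sup>+p. log_kernel_neg p \<partial>?P)"
    using sup by (rule add_right_mono)
  finally have main: "(\<integral>\<^sup>+p. log_kernel_pos p \<partial>?P) + ennreal (ln d)
      \<le> ennreal (V + ln d) + (\<integral>\<^sup>+p. log_kernel_neg p \<partial>?P)" .
  \<comment> \<open>\<open>ennreal\<close> sends negative reals to 0, so this sign is needed before
    the summands can be merged and compared as reals.\<close>
  have "0 \<le> V + ln d"
    using kint(2)[of 0] Bochner_Integration.integral_nonneg[of ?P "k 0"] k0 by force
  obtain c where c: "0 \<le> c" "(\<integral>\<^sup>+p. log_kernel_neg p \<partial>?P) = ennreal c"
    using neg by (cases "\<integral>\<^sup>+p. log_kernel_neg p \<partial>?P") (auto simp: top_unique)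
  have "(\<integral>\<^sup>+p. log_kernel_pos p \<partial>?P) + ennreal (ln d) \<le> ennreal (V + ln d + c)"
    using main \<open>0 \<le> V + ln d\<close> c by simp
  then obtain a where a: "0 \<le> a" "(\<integral>\<^sup>+p. log_kernel_pos p \<partial>?P) = ennreal a"
    by (cases "\<integral>\<^sup>+p. log_kernel_pos p \<partial>?P") (auto simp: top_unique)
  have "ennreal (a + ln d) \<le> ennreal (V + ln d + c)"
    using main \<open>0 \<le> V + ln d\<close> c a ld by simp
  then have "a \<le> V + c"
    using \<open>0 \<le> V + ln d\<close> c by (subst (asm) ennreal_le_iff) auto
  then show ?thesis
    unfolding log_energy_def a(2) c(2) using a(1) c(1) by simp
qed

text \<open>At a fixed level \<open>M\<close> the empirical double averages are bounded by
  \<open>trunc_log_leja_sum\<close>, and the share of the diagonal is at most \<open>M\<close>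
  divided by the number of points. It vanishes in the limit, leaving \<open>- ln b\<close>; only
  then does \<open>M\<close> grow. Pointwise convergence of \<open>X n\<close> to \<open>Y\<close>
  replaces weak convergence of product measures by two applications of dominated
  convergence.\<close>

lemma leja_measure:
  fixes x :: "nat \<Rightarrow> complex"
  assumes K: "compact K" and x: "\<And>i. x i \<in> K" and b: "0 < b"
    and leja: "\<And>i. b ^ i \<le> (\<Prod>j<i. cmod (x i - x j))"
  obtains \<mu> where "prob_space \<mu>" "sets \<mu> = sets borel" "emeasure \<mu> K = 1" "log_energy \<mu> \<le> ereal (- ln b)"
proof -
  obtain \<Omega> :: "real measure" and r :: "nat \<Rightarrow> nat" and X :: "nat \<Rightarrow> real \<Rightarrow> complex"
    and Y :: "real \<Rightarrow> complex" where \<Omega>: "prob_space \<Omega>" and r: "strict_mono r"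
    and Xm [measurable]: "\<And>n. X n \<in> borel_measurable \<Omega>" and Ym [measurable]: "Y \<in> borel_measurable \<Omega>"
    and Xd: "\<And>n (f :: complex \<Rightarrow> real). f \<in> borel_measurable borel \<Longrightarrow>
       (\<integral>\<omega>. f (X n \<omega>) \<partial>\<Omega>) = (\<Sum>i\<le>r n. f (x i)) / real (Suc (r n))"
    and XK: "\<And>n. AE \<omega> in \<Omega>. X n \<omega> \<in> K"
    and lim: "\<And>\<omega>. \<omega> \<in> space \<Omega> \<Longrightarrow> (\<lambda>n. X n \<omega>) \<longlonglongrightarrow> Y \<omega>"
    by (rule empirical_limit[where x = x, OF K x]) (rule that)
  interpret \<Omega>: prob_space \<Omega> by fact
  define \<mu> where "\<mu> = distr \<Omega> borel Y"
  have sets [simp]: "sets \<mu> = sets borel" by (simp add: \<mu>_def)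
  interpret \<mu>: prob_space \<mu> unfolding \<mu>_def by (rule \<Omega>.prob_space_distr) simp
  have Kb [measurable]: "K \<in> sets borel" using K by (rule borel_compact)
  have "AE \<omega> in \<Omega>. \<forall>n. X n \<omega> \<in> K" using XK by (simp add: AE_all_countable)
  then have YK: "AE \<omega> in \<Omega>. Y \<omega> \<in> K"
    using AE_space
  proof eventually_elim
    case (elim \<omega>)
    then show ?case
      using closed_sequentially[OF compact_imp_closed[OF K], of "\<lambda>n. X n \<omega>" "Y \<omega>"] lim by auto
  qed
  have \<mu>K: "AE z in \<mu>. z \<in> K"
    unfolding \<mu>_def using YK by (subst AE_distr_iff) auto
  have "emeasure \<mu> K = 1"
    using \<mu>K by (intro \<mu>.emeasure_eq_1_AE) auto
  obtain R where R: "\<And>z. z \<in> K \<Longrightarrow> cmod z \<le> R"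
    using compact_imp_bounded[OF K] by (auto simp: bounded_iff)
  define d where "d = max 1 (2 * R)"
  have d: "\<forall>z\<in>K. \<forall>w\<in>K. cmod (z - w) \<le> d"
  proof (intro ballI)
    fix z w assume "z \<in> K" "w \<in> K"
    then show "cmod (z - w) \<le> d"
      using R[of z] R[of w] norm_triangle_ineq4[of z w] by (auto simp: d_def)
  qed
  have d1: "1 \<le> d" by (simp add: d_def)
  have "(\<integral>z. \<integral>w. trunc_log d M z w \<partial>\<mu> \<partial>\<mu>) \<le> - ln b" if M: "0 \<le> M" for M
  proof -
    let ?k = "trunc_log d M"
    have inner: "(\<lambda>n. \<integral>\<omega>'. ?k (X n \<omega>) (X n \<omega>') \<partial>\<Omega>) \<longlonglongrightarrow> (\<integral>\<omega>'. ?k (Y \<omega>) (Y \<omega>') \<partial>\<Omega>)" if "\<omega> \<in> space \<Omega>" for \<omega>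
      by (rule integral_dominated_convergence[where w = "\<lambda>_. M + ln d"])
        (auto intro!: tendsto_trunc_log lim that trunc_log_abs d1 M)
    have bd: "\<bar>\<integral>\<omega>'. ?k (X n \<omega>) (X n \<omega>') \<partial>\<Omega>\<bar> \<le> M + ln d" for n \<omega>
    proof -
      have "\<bar>\<integral>\<omega>'. ?k (X n \<omega>) (X n \<omega>') \<partial>\<Omega>\<bar> \<le> (\<integral>\<omega>'. \<bar>?k (X n \<omega>) (X n \<omega>')\<bar> \<partial>\<Omega>)"
        by (rule integral_abs_bound)
      also have "\<dots> \<le> (\<integral>\<omega>'. M + ln d \<partial>\<Omega>)"
        using trunc_log_abs[OF d1 M] d1 M
        by (intro integral_mono integrable_abs \<Omega>.integrable_const_bound[where B = "M + ln d"]) auto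
      finally show ?thesis by (simp add: \<Omega>.prob_space)
    qed
    have outer: "(\<lambda>n. \<integral>\<omega>. \<integral>\<omega>'. ?k (X n \<omega>) (X n \<omega>') \<partial>\<Omega> \<partial>\<Omega>) \<longlonglongrightarrow> (\<integral>\<omega>. \<integral>\<omega>'. ?k (Y \<omega>) (Y \<omega>') \<partial>\<Omega> \<partial>\<Omega>)"
      by (rule integral_dominated_convergence[where w = "\<lambda>_. M + ln d"]) (auto intro!: inner bd)
    have val: "(\<integral>\<omega>. \<integral>\<omega>'. ?k (X n \<omega>) (X n \<omega>') \<partial>\<Omega> \<partial>\<Omega>)
        = (\<Sum>i\<le>r n. \<Sum>j\<le>r n. ?k (x i) (x j)) / (real (Suc (r n)))\<^sup>2" for n
    proof -
      have "(\<integral>\<omega>'. ?k z (X n \<omega>') \<partial>\<Omega>) = (\<Sum>j\<le>r n. ?k z (x j)) / real (Suc (r n))" for z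
        by (rule Xd) simp
      then have "(\<integral>\<omega>. \<integral>\<omega>'. ?k (X n \<omega>) (X n \<omega>') \<partial>\<Omega> \<partial>\<Omega>) = (\<integral>\<omega>. (\<Sum>j\<le>r n. ?k (X n \<omega>) (x j)) / real (Suc (r n)) \<partial>\<Omega>)"
        by simp
      also have "\<dots> = (\<Sum>i\<le>r n. (\<Sum>j\<le>r n. ?k (x i) (x j)) / real (Suc (r n))) / real (Suc (r n))"
        by (rule Xd) simp
      finally show ?thesis by (simp add: power2_eq_square sum_divide_distrib)
    qed
    have le: "(\<integral>\<omega>. \<integral>\<omega>'. ?k (X n \<omega>) (X n \<omega>') \<partial>\<Omega> \<partial>\<Omega>) \<le> M * (1 / real (Suc (r n))) - ln b * (1 - 1 / real (Suc (r n)))" for n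
    proof -
      have "(\<integral>\<omega>. \<integral>\<omega>'. ?k (X n \<omega>) (X n \<omega>') \<partial>\<Omega> \<partial>\<Omega>)
          \<le> ((real (r n) + 1) * M - ln b * (real (r n) * (real (r n) + 1))) / (real (Suc (r n)))\<^sup>2"
        unfolding val using trunc_log_leja_sum[OF b leja d1 _ M, of "r n"] d x
        by (intro divide_right_mono) auto
      also have "\<dots> = M * (1 / real (Suc (r n))) - ln b * (1 - 1 / real (Suc (r n)))"
        by (simp add: field_simps power2_eq_square)
      finally show ?thesis .
    qed
    have "(\<lambda>n. 1 / real (Suc (r n))) \<longlonglongrightarrow> 0"
      using LIMSEQ_subseq_LIMSEQ[OF LIMSEQ_inverse_real_of_nat r] by (simp add: comp_def inverse_eq_divide)
    then have "(\<lambda>n. M * (1 / real (Suc (r n))) - ln b * (1 - 1 / real (Suc (r n)))) \<longlonglongrightarrow> M * 0 - ln b * (1 - 0)"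
      by (intro tendsto_intros)
    from LIMSEQ_le[OF outer this] le
    have "(\<integral>\<omega>. \<integral>\<omega>'. ?k (Y \<omega>) (Y \<omega>') \<partial>\<Omega> \<partial>\<Omega>) \<le> - ln b" by simp
    moreover have "(\<integral>z. \<integral>w. ?k z w \<partial>\<mu> \<partial>\<mu>) = (\<integral>\<omega>. \<integral>\<omega>'. ?k (Y \<omega>) (Y \<omega>') \<partial>\<Omega> \<partial>\<Omega>)"
    proof -
      have "(\<integral>w. ?k z w \<partial>\<mu>) = (\<integral>\<omega>'. ?k z (Y \<omega>') \<partial>\<Omega>)" for z
        unfolding \<mu>_def by (rule integral_distr) simp_all
      then have "(\<integral>z. \<integral>w. ?k z w \<partial>\<mu> \<partial>\<mu>) = (\<integral>z. \<integral>\<omega>'. ?k z (Y \<omega>') \<partial>\<Omega> \<partial>\<mu>)" by simp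
      also have "\<dots> = (\<integral>\<omega>. \<integral>\<omega>'. ?k (Y \<omega>) (Y \<omega>') \<partial>\<Omega> \<partial>\<Omega>)"
        unfolding \<mu>_def by (rule integral_distr) auto
      finally show ?thesis .
    qed
    ultimately show ?thesis by simp
  qed
  from log_energy_le_truncated[OF \<mu>.prob_space_axioms sets Kb \<mu>K d1 d this]
  have "log_energy \<mu> \<le> ereal (- ln b)" .
  then show ?thesis
    using that[OF \<mu>.prob_space_axioms sets \<open>emeasure \<mu> K = 1\<close>] by blast
qed

text \<open>\<open>real_of_ereal\<close> sends minus infinity to 0, which would turn an infinite
  negative Robin constant into capacity 1. The bound on the negative part excludes this: every
  competing energy is at least \<open>- ln d\<close>.\<close>

lemma robin_const_not_MInf:
  assumes "compact K"
  shows "robin_const K \<noteq> - \<infinity>"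
proof -
  obtain R where R: "\<And>z. z \<in> K \<Longrightarrow> cmod z \<le> R"
    using compact_imp_bounded[OF assms] by (auto simp: bounded_iff)
  define d where "d = max 1 (2 * R)"
  have d: "\<forall>z\<in>K. \<forall>w\<in>K. cmod (z - w) \<le> d"
  proof (intro ballI)
    fix z w assume "z \<in> K" "w \<in> K"
    then show "cmod (z - w) \<le> d"
      using R[of z] R[of w] norm_triangle_ineq4[of z w] by (auto simp: d_def)
  qed
  have d1: "1 \<le> d" by (simp add: d_def)
  have Kb: "K \<in> sets borel" using assms by (rule borel_compact)
  have "ereal (- ln d) \<le> log_energy \<mu>"
    if \<mu>: "prob_space \<mu>" "sets \<mu> = sets borel" "emeasure \<mu> K = 1" for \<mu>
  proof -
    interpret prob_space \<mu> by fact
    have "AE z in \<mu>. z \<in> K"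
      using \<mu> Kb by (intro AE_in_set_eq_1[THEN iffD2]) (auto simp: measure_def)
    from nn_integral_log_kernel_neg_le[OF \<mu>(1,2) Kb this d1 d]
    obtain c where c: "0 \<le> c" "c \<le> ln d" "(\<integral>\<^sup>+p. log_kernel_neg p \<partial>(\<mu> \<Otimes>\<^sub>M \<mu>)) = ennreal c"
      using d1 by (cases "\<integral>\<^sup>+p. log_kernel_neg p \<partial>(\<mu> \<Otimes>\<^sub>M \<mu>)") (auto simp: top_unique)
    have "ereal (- ln d) \<le> 0 - ereal c" using c by simp
    also have "\<dots> \<le> log_energy \<mu>"
      unfolding log_energy_def c(3) using c(1) by (intro ereal_minus_mono) auto
    finally show ?thesis .
  qed
  then have "ereal (- ln d) \<le> robin_const K"
    unfolding robin_const_def by (intro Inf_greatest) auto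
  then show ?thesis by auto
qed

text \<open>If every such polynomial reached \<open>b ^ n\<close> in modulus somewhere on
  \<open>K\<close>, those places could be chosen successively as a Leja sequence, and its limit
  measure would force the capacity up to at least \<open>b\<close>. The zeros are sought in
  \<open>C\<close> rather than in \<open>K\<close>, so that an empty \<open>K\<close> is
  allowed.\<close>

lemma exists_small_monic_polynomial:
  assumes K: "compact K" "K \<subseteq> C" "C \<noteq> {}" and b: "log_capacity K < b"
  obtains n :: nat and x :: "nat \<Rightarrow> complex" where "0 < n" "\<And>j. x j \<in> C"
    "\<And>\<zeta>. \<zeta> \<in> K \<Longrightarrow> (\<Prod>j<n. cmod (\<zeta> - x j)) < b ^ n"
proof -
  have b0: "0 < b" using b by (rule le_less_trans[rotated]) (simp add: log_capacity_def)
  obtain z1 where z1: "z1 \<in> C" using K(3) by blast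
  have "\<exists>n>0. \<exists>x :: nat \<Rightarrow> complex. (\<forall>j. x j \<in> C) \<and> (\<forall>\<zeta>\<in>K. (\<Prod>j<n. cmod (\<zeta> - x j)) < b ^ n)"
  proof (rule ccontr)
    assume "\<not> ?thesis"
    then have *: "\<exists>\<zeta>\<in>K. b ^ n \<le> (\<Prod>j<n. cmod (\<zeta> - x j))" if "0 < n" "\<forall>j. x j \<in> C" for n and x :: "nat \<Rightarrow> complex"
      using that by (meson not_le)
    \<comment> \<open>The negated claim in degree 1 shows that \<open>K\<close> is nonempty; this
      supplies the first Leja point, for which the empty product imposes no condition.\<close>
    obtain z0 where z0: "z0 \<in> K" using *[of 1 "\<lambda>_. z1"] z1 by auto
    have "\<exists>x. \<forall>i. x i \<in> K \<and> b ^ i \<le> (\<Prod>j<i. cmod (x i - x j))"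
    proof (rule dependent_wellorder_choice)
      fix i :: nat and x :: "nat \<Rightarrow> complex"
      assume IH: "\<And>j. j < i \<Longrightarrow> x j \<in> K \<and> b ^ j \<le> (\<Prod>k<j. cmod (x j - x k))"
      show "\<exists>r. r \<in> K \<and> b ^ i \<le> (\<Prod>j<i. cmod (r - x j))"
      proof (cases "i = 0")
        case False
        \<comment> \<open>The negated claim speaks of whole sequences in \<open>C\<close>, so the
          finitely many chosen points are padded with \<open>z1\<close>.\<close>
        define y where "y j = (if j < i then x j else z1)" for j
        have "\<forall>j. y j \<in> C" using IH K(2) z1 by (auto simp: y_def)
        then obtain \<zeta> where "\<zeta> \<in> K" "b ^ i \<le> (\<Prod>j<i. cmod (\<zeta> - y j))"
          using *[of i y] False by blast
        moreover have "(\<Prod>j<i. cmod (\<zeta> - y j)) = (\<Prod>j<i. cmod (\<zeta> - x j))"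
          by (intro prod.cong) (auto simp: y_def)
        ultimately show ?thesis by auto
      qed (use z0 in auto)
    qed auto
    then obtain x where x: "\<And>i. x i \<in> K" "\<And>i. b ^ i \<le> (\<Prod>j<i. cmod (x i - x j))" by blast
    obtain \<mu> where \<mu>: "prob_space \<mu>" "sets \<mu> = sets borel" "emeasure \<mu> K = 1" "log_energy \<mu> \<le> ereal (- ln b)"
      by (rule leja_measure[where x = x, OF K(1) x(1) b0 x(2)])
    have "robin_const K \<le> log_energy \<mu>"
      unfolding robin_const_def using \<mu> by (intro Inf_lower) auto
    with \<mu>(4) have le: "robin_const K \<le> ereal (- ln b)" by (rule order_trans[rotated])
    then obtain v where v: "robin_const K = ereal v"
      using robin_const_not_MInf[OF K(1)] by (cases "robin_const K") auto
    have "b = exp (ln b)" using b0 by simp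
    also have "\<dots> \<le> log_capacity K"
      using le by (simp only: v log_capacity_def) simp
    finally show False using b by simp
  qed
  then show ?thesis using that by blast
qed

section \<open>Smooth functions and Caccioppoli's inequality\<close>

lemma has_derivative_dx_dy:
  assumes "(f has_derivative f') (at z)"
  shows "dx f z = f' 1" "dy f z = f' \<i>"
  using frechet_derivative_at[OF assms] by (simp_all add: dx_def dy_def)

lemma
  assumes "f differentiable (at z)" "g differentiable (at z)"
  shows dx_add: "dx (\<lambda>z. f z + g z) z = dx f z + dx g z"
    and dy_add: "dy (\<lambda>z. f z + g z) z = dy f z + dy g z"
    and dx_mult: "dx (\<lambda>z. f z * g z) z = f z * dx g z + dx f z * g z"
    and dy_mult: "dy (\<lambda>z. f z * g z) z = f z * dy g z + dy f z * g z"
proof -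
  have f: "(f has_derivative frechet_derivative f (at z)) (at z)"
   and g: "(g has_derivative frechet_derivative g (at z)) (at z)"
    using assms by (simp_all add: frechet_derivative_works)
  show "dx (\<lambda>z. f z + g z) z = dx f z + dx g z" "dy (\<lambda>z. f z + g z) z = dy f z + dy g z"
    using has_derivative_dx_dy[OF has_derivative_add[OF f g]] by (simp_all add: dx_def dy_def)
  show "dx (\<lambda>z. f z * g z) z = f z * dx g z + dx f z * g z" "dy (\<lambda>z. f z * g z) z = f z * dy g z + dy f z * g z"
    using has_derivative_dx_dy[OF has_derivative_mult[OF f g]] by (simp_all add: dx_def dy_def)
qed

lemma
  assumes "(h has_real_derivative D) (at (f z))" "f differentiable (at z)"
  shows differentiable_comp_real: "(\<lambda>z. h (f z)) differentiable (at z)"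
    and dx_comp: "dx (\<lambda>z. h (f z)) z = D * dx f z"
    and dy_comp: "dy (\<lambda>z. h (f z)) z = D * dy f z"
proof -
  have f: "(f has_derivative frechet_derivative f (at z)) (at z)"
    using assms by (simp add: frechet_derivative_works)
  have c: "((\<lambda>z. h (f z)) has_derivative (\<lambda>x. D * frechet_derivative f (at z) x)) (at z)"
    using has_derivative_compose[OF f assms(1)[unfolded has_field_derivative_def]] .
  then show "(\<lambda>z. h (f z)) differentiable (at z)"
    by (rule differentiableI)
  show "dx (\<lambda>z. h (f z)) z = D * dx f z" "dy (\<lambda>z. h (f z)) z = D * dy f z"
    using has_derivative_dx_dy[OF c] by (simp_all add: dx_def dy_def)
qed

text \<open>A class witnessing \<open>smooth_fun\<close> must be closed under both partial
  derivatives. By the sum and product rules the algebra generated by \<open>G\<close> has this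
  property as soon as the derivatives of the generators lie in it.\<close>

inductive_set fun_algebra :: "(complex \<Rightarrow> real) set \<Rightarrow> (complex \<Rightarrow> real) set" for G where
  gen: "g \<in> G \<Longrightarrow> g \<in> fun_algebra G"
| add: "f \<in> fun_algebra G \<Longrightarrow> g \<in> fun_algebra G \<Longrightarrow> (\<lambda>z. f z + g z) \<in> fun_algebra G"
| mult: "f \<in> fun_algebra G \<Longrightarrow> g \<in> fun_algebra G \<Longrightarrow> (\<lambda>z. f z * g z) \<in> fun_algebra G"

lemma smooth_fun_algebra:
  assumes "\<And>g z. g \<in> G \<Longrightarrow> g differentiable (at z)"
    and "\<And>g. g \<in> G \<Longrightarrow> dx g \<in> fun_algebra G" "\<And>g. g \<in> G \<Longrightarrow> dy g \<in> fun_algebra G"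
    and "f \<in> fun_algebra G"
  shows "smooth_fun f"
proof -
  have "(\<forall>z. g differentiable (at z)) \<and> dx g \<in> fun_algebra G \<and> dy g \<in> fun_algebra G"
    if "g \<in> fun_algebra G" for g
    using that
  proof induction
    case (gen g)
    then show ?case using assms by blast
  next
    case (add f g)
    then have "dx (\<lambda>z. f z + g z) = (\<lambda>z. dx f z + dx g z)" "dy (\<lambda>z. f z + g z) = (\<lambda>z. dy f z + dy g z)"
      by (auto simp: dx_add dy_add)
    with add show ?case
      by (auto intro: fun_algebra.add)
  next
    case (mult f g)
    then have "dx (\<lambda>z. f z * g z) = (\<lambda>z. f z * dx g z + dx f z * g z)"
        "dy (\<lambda>z. f z * g z) = (\<lambda>z. f z * dy g z + dy f z * g z)"
      by (auto simp: dx_mult dy_mult)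
    with mult show ?case
      by (auto intro: fun_algebra.intros(2,3))
  qed
  with assms(4) show ?thesis
    unfolding smooth_fun_def by blast
qed

lemma
  assumes "smooth_fun f"
  shows smooth_fun_differentiable: "f differentiable (at z)"
    and smooth_fun_dx: "smooth_fun (dx f)"
    and smooth_fun_dy: "smooth_fun (dy f)"
  using assms unfolding smooth_fun_def by blast+

lemma smooth_fun_continuous: "smooth_fun f \<Longrightarrow> continuous_on S f"
  by (meson continuous_at_imp_continuous_on differentiable_imp_continuous_within smooth_fun_differentiable)

lemma smooth_fun_const: "smooth_fun (\<lambda>z. c)"
proof (rule smooth_fun_algebra[where G = "range (\<lambda>c z. c)"])
  have c: "dx (\<lambda>z. c) = (\<lambda>z. 0)" "dy (\<lambda>z. c) = (\<lambda>z. 0)" for c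
    using has_derivative_dx_dy[OF has_derivative_const] by auto
  show "dx g \<in> fun_algebra (range (\<lambda>c z. c))" "dy g \<in> fun_algebra (range (\<lambda>c z. c))"
    if "g \<in> range (\<lambda>c z. c)" for g
    using that by (auto simp: c intro!: fun_algebra.gen)
qed (auto intro!: fun_algebra.gen)

lemma smooth_fun_bounded_linear:
  assumes "bounded_linear f"
  shows "smooth_fun f"
proof (rule smooth_fun_algebra[where G = "insert f (Collect smooth_fun)"])
  have d: "(f has_derivative f) (at z)" for z
    using assms by (rule bounded_linear_imp_has_derivative)
  have "dx f = (\<lambda>z. f 1)" "dy f = (\<lambda>z. f \<i>)"
    using has_derivative_dx_dy[OF d] by auto
  then show "dx g \<in> fun_algebra (insert f (Collect smooth_fun))" "dy g \<in> fun_algebra (insert f (Collect smooth_fun))"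
    if "g \<in> insert f (Collect smooth_fun)" for g
    using that by (auto simp: smooth_fun_const smooth_fun_dx smooth_fun_dy intro!: fun_algebra.gen)
  show "g differentiable (at z)" if "g \<in> insert f (Collect smooth_fun)" for g z
    using that d smooth_fun_differentiable by (auto intro: differentiableI)
qed (auto intro!: fun_algebra.gen)

lemma
  assumes "smooth_fun f" "smooth_fun g"
  shows smooth_fun_add: "smooth_fun (\<lambda>z. f z + g z)"
    and smooth_fun_mult: "smooth_fun (\<lambda>z. f z * g z)"
proof -
  have "smooth_fun h" if "h \<in> fun_algebra (Collect smooth_fun)" for h
    using smooth_fun_differentiable smooth_fun_dx smooth_fun_dy
    by (intro smooth_fun_algebra[OF _ _ _ that]) (simp_all add: fun_algebra.gen)
  then show "smooth_fun (\<lambda>z. f z + g z)" "smooth_fun (\<lambda>z. f z * g z)"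
    using assms by (simp_all add: fun_algebra.intros)
qed

lemma smooth_fun_power: "smooth_fun f \<Longrightarrow> smooth_fun (\<lambda>z. f z ^ n)"
  by (induction n) (auto intro: smooth_fun_mult smooth_fun_const)

definition real_smooth :: "(real \<Rightarrow> real) \<Rightarrow> bool" where
  "real_smooth h \<longleftrightarrow> (\<exists>H. h \<in> H \<and> (\<forall>g\<in>H. \<exists>g'\<in>H. \<forall>t. (g has_real_derivative g' t) (at t)))"

text \<open>By the chain rule a partial derivative of \<open>k (f z)\<close> is
  \<open>k' (f z)\<close> times one of \<open>f\<close>. So the smooth functions together with all
  compositions of members of \<open>H\<close> with \<open>f\<close> generate a suitable
  algebra.\<close>

lemma smooth_fun_comp:
  assumes "real_smooth h" "smooth_fun f"
  shows "smooth_fun (\<lambda>z. h (f z))"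
proof -
  obtain H where "h \<in> H" and H: "\<And>g. g \<in> H \<Longrightarrow> \<exists>g'\<in>H. \<forall>t. (g has_real_derivative g' t) (at t)"
    using assms(1) unfolding real_smooth_def by blast
  let ?G = "Collect smooth_fun \<union> (\<lambda>g z. g (f z)) ` H"
  show ?thesis
  proof (rule smooth_fun_algebra[where G = ?G])
    have *: "(\<forall>z. g differentiable (at z)) \<and> dx g \<in> fun_algebra ?G \<and> dy g \<in> fun_algebra ?G" if "g \<in> ?G" for g
      using that
    proof
      assume "g \<in> Collect smooth_fun"
      then show ?thesis
        by (auto simp: smooth_fun_dx smooth_fun_dy smooth_fun_differentiable intro!: fun_algebra.gen)
    next
      assume "g \<in> (\<lambda>g z. g (f z)) ` H"
      then obtain k where k: "k \<in> H" "g = (\<lambda>z. k (f z))" by blast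
      obtain k' where k': "k' \<in> H" "\<And>t. (k has_real_derivative k' t) (at t)"
        using H[OF k(1)] by blast
      note f = smooth_fun_differentiable[OF assms(2)]
      have "dx g = (\<lambda>z. k' (f z) * dx f z)" "dy g = (\<lambda>z. k' (f z) * dy f z)"
        unfolding k(2) using dx_comp[OF k'(2) f] dy_comp[OF k'(2) f] by auto
      moreover have "(\<lambda>z. k' (f z)) \<in> fun_algebra ?G" "dx f \<in> fun_algebra ?G" "dy f \<in> fun_algebra ?G"
        using k'(1) assms(2) by (auto intro!: fun_algebra.gen smooth_fun_dx smooth_fun_dy)
      moreover have "g differentiable (at z)" for z
        unfolding k(2) using differentiable_comp_real[OF k'(2) f] .
      ultimately show ?thesis
        by (auto intro: fun_algebra.mult)
    qed
    then show "g differentiable (at z)" "dx g \<in> fun_algebra ?G" "dy g \<in> fun_algebra ?G" if "g \<in> ?G" for g z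
      using that by blast+
    show "(\<lambda>z. h (f z)) \<in> fun_algebra ?G"
      using \<open>h \<in> H\<close> by (auto intro!: fun_algebra.gen)
  qed
qed

section \<open>Functions that vanish to infinite order at the edge of their support\<close>

definition flat_exp :: "nat \<Rightarrow> real \<Rightarrow> real" where
  "flat_exp k t = (if t \<le> 0 then 0 else exp (- (1 / t)) / t ^ k)"

lemma flat_exp_nonneg: "0 \<le> flat_exp k t"
  by (simp add: flat_exp_def)

text \<open>The single term of degree \<open>k + m\<close> in the series of
  \<open>exp (1 / t)\<close> suffices. The case \<open>m = 2\<close> gives the derivative at 0, the
  case \<open>m = 0\<close> a uniform bound.\<close>

lemma flat_exp_le: 
  assumes "0 \<le> t"
  shows "flat_exp k t \<le> fact (k + m) * t ^ m"
proof (cases "t = 0")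
  case False
  with assms have t: "0 < t" by simp
  have "(1 / t) ^ (k + m) / fact (k + m) \<le> exp (1 / t)"
  proof -
    have "(\<Sum>n\<in>{k + m}. (1 / t) ^ n /\<^sub>R fact n) \<le> (\<Sum>n. (1 / t) ^ n /\<^sub>R fact n)"
      using t by (intro sum_le_suminf summable_exp_generic) auto
    then show ?thesis
      by (simp add: exp_def divide_inverse mult.commute)
  qed
  then have "exp (- (1 / t)) \<le> fact (k + m) * t ^ (k + m)"
    using t by (simp add: exp_minus field_simps)
  then show ?thesis
    using t by (simp add: flat_exp_def divide_le_eq power_add mult_ac)
qed (simp add: flat_exp_def)

text \<open>The powers of \<open>t\<close> in the denominator of \<open>flat_exp\<close> serve this
  formula: they close the family under differentiation. At 0 the difference quotient is of order
  \<open>h\<close> by \<open>flat_exp_le\<close>.\<close>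

lemma flat_exp_has_derivative:
  "(flat_exp k has_real_derivative (flat_exp (k + 2) t - real k * flat_exp (k + 1) t)) (at t)"
proof -
  consider "t < 0" | "t = 0" | "t > 0" by linarith
  then show ?thesis
  proof cases
    case 1
    have "((\<lambda>_. 0) has_real_derivative 0) (at t)" by simp
    then have "(flat_exp k has_real_derivative 0) (at t)"
      by (rule has_field_derivative_transform_within_open[of _ _ _ "{..<0}"])
        (use 1 in \<open>auto simp: flat_exp_def\<close>)
    then show ?thesis using 1 by (simp add: flat_exp_def)
  next
    case 2
    have "((\<lambda>h. flat_exp k h / h) \<longlongrightarrow> 0) (at 0)"
    proof (rule tendsto_rabs_zero_cancel, rule real_tendsto_sandwich[where f = "\<lambda>_. 0"])
      show "\<forall>\<^sub>F h in at 0. \<bar>flat_exp k h / h\<bar> \<le> fact (k + 2) * \<bar>h\<bar>"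
      proof (rule always_eventually, rule allI)
        fix h :: real
        show "\<bar>flat_exp k h / h\<bar> \<le> fact (k + 2) * \<bar>h\<bar>"
        proof (cases "h > 0")
          case True
          then show ?thesis
            using flat_exp_le[of h k 2] flat_exp_nonneg[of k h]
            by (simp add: field_simps power2_eq_square)
        next
          case False
          then have "flat_exp k h = 0" by (simp add: flat_exp_def)
          then show ?thesis by simp
        qed
      qed
      show "((\<lambda>h::real. fact (k + 2) * \<bar>h\<bar>) \<longlongrightarrow> 0) (at 0)"
        by (intro tendsto_mult_right_zero tendsto_rabs_zero tendsto_ident_at)
    qed auto
    then show ?thesis
      using 2 by (simp add: has_field_derivative_iff flat_exp_def[of _ 0])
  next
    case 3
    have "((\<lambda>t. exp (- (1 / t)) / t ^ k) has_real_derivative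
            (exp (- (1/t)) / t^2 * t ^ k - exp (- (1/t)) * (real k * t ^ (k - 1))) / (t ^ k)^2) (at t)"
      using 3 by (auto intro!: derivative_eq_intros simp: power2_eq_square)
    also have "(exp (- (1/t)) / t^2 * t ^ k - exp (- (1/t)) * (real k * t ^ (k - 1))) / (t ^ k)^2
       = flat_exp (k + 2) t - real k * flat_exp (k + 1) t"
      using 3 by (cases k) (auto simp: flat_exp_def field_simps power2_eq_square)
    finally show ?thesis
      by (rule has_field_derivative_transform_within_open[of _ _ _ "{0<..}"])
        (use 3 in \<open>auto simp: flat_exp_def\<close>)
  qed
qed

lemma flat_exp_0_le_1: "flat_exp 0 t \<le> 1"
  by (simp add: flat_exp_def)

lemma flat_exp_0_mono: "s \<le> t \<Longrightarrow> flat_exp 0 s \<le> flat_exp 0 t"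
  by (auto simp: flat_exp_def intro: divide_left_mono)

text \<open>The factor \<open>1 / t ^ m\<close> makes the family closed under differentiation.\<close>

definition flat_log :: "real \<Rightarrow> real \<Rightarrow> nat \<Rightarrow> nat \<Rightarrow> real \<Rightarrow> real" where
  "flat_log a c k m t = (if t \<le> 0 then 0 else flat_exp k (a * ln t - c) / t ^ m)"

text \<open>Below \<open>exp (c / a)\<close> either \<open>t\<close> is nonpositive or the argument
  of \<open>flat_exp\<close> is negative, so the function is locally 0 and the singularity of the
  logarithm is never met. From \<open>exp (c / a)\<close> on, \<open>t\<close> is positive and the
  chain rule applies.\<close>

lemma flat_log_has_derivative:
  assumes "a > 0"
  shows "(flat_log a c k m has_real_derivative
     (a * flat_log a c (k + 2) (m + 1) t - a * real k * flat_log a c (k + 1) (m + 1) t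
       - real m * flat_log a c k (m + 1) t)) (at t)"
proof (cases "t < exp (c / a)")
  case True
  have z: "flat_log a c k m t = 0" if "t < exp (c / a)" for t k m
  proof (cases "t \<le> 0")
    case False
    then have "ln t < c / a" using that by (metis exp_less_cancel_iff exp_ln not_le)
    then show ?thesis using assms by (simp add: flat_log_def flat_exp_def field_simps)
  qed (simp add: flat_log_def)
  have "((\<lambda>_. 0) has_real_derivative 0) (at t)" by simp
  then have "(flat_log a c k m has_real_derivative 0) (at t)"
    by (rule has_field_derivative_transform_within_open[of _ _ _ "{..<exp (c / a)}"])
      (use True in \<open>auto simp: z\<close>)
  then show ?thesis using True by (simp add: z)
next
  case False
  then have t: "t > 0" using exp_gt_zero[of "c / a"] by linarith
  have 1: "((\<lambda>t. flat_exp k (a * ln t - c)) has_real_derivative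
      (flat_exp (k + 2) (a * ln t - c) - real k * flat_exp (k + 1) (a * ln t - c)) * (a / t)) (at t)"
    by (rule DERIV_chain2[OF flat_exp_has_derivative]) (use t in \<open>auto intro!: derivative_eq_intros\<close>)
  have "((\<lambda>t. flat_exp k (a * ln t - c) / t ^ m) has_real_derivative
      ((flat_exp (k + 2) (a * ln t - c) - real k * flat_exp (k + 1) (a * ln t - c)) * (a / t) * t ^ m
        - flat_exp k (a * ln t - c) * (real m * t ^ (m - 1))) / (t ^ m * t ^ m)) (at t)"
    by (rule DERIV_divide[OF 1]) (use t in \<open>auto intro!: derivative_eq_intros\<close>)
  also have "((flat_exp (k + 2) (a * ln t - c) - real k * flat_exp (k + 1) (a * ln t - c)) * (a / t) * t ^ m
        - flat_exp k (a * ln t - c) * (real m * t ^ (m - 1))) / (t ^ m * t ^ m)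
     = a * flat_log a c (k + 2) (m + 1) t - a * real k * flat_log a c (k + 1) (m + 1) t
       - real m * flat_log a c k (m + 1) t"
    using t by (cases m) (simp_all add: flat_log_def field_simps)
  finally show ?thesis
    by (rule has_field_derivative_transform_within_open[of _ _ _ "{0<..}"])
      (use t in \<open>auto simp: flat_log_def\<close>)
qed

text \<open>The finite linear combinations of the \<open>B j\<close> form a class closed under
  differentiation. The list \<open>D i\<close> encodes the derivative of \<open>B i\<close> by its
  coefficients and indices.\<close>

lemma real_smooth_span:
  fixes B :: "'i \<Rightarrow> real \<Rightarrow> real" and D :: "'i \<Rightarrow> (real \<times> 'i) list"
  assumes "\<And>i t. (B i has_real_derivative (\<Sum>(c, j)\<leftarrow>D i. c * B j t)) (at t)"
  shows "real_smooth (B i)"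
proof -
  define comb where "comb l t = (\<Sum>(c, j)\<leftarrow>l. c * B j t)" for l t
  have "\<exists>l'. \<forall>t. (comb l has_real_derivative comb l' t) (at t)" for l
  proof (induction l)
    case Nil
    have "comb [] = (\<lambda>t. 0)" by (simp add: comb_def fun_eq_iff)
    then show ?case by (intro exI[of _ "[]"]) simp
  next
    case (Cons p l)
    obtain c j where p: "p = (c, j)" by (cases p)
    obtain l' where l': "\<And>t. (comb l has_real_derivative comb l' t) (at t)"
      using Cons by blast
    have s: "comb (map (\<lambda>(d, j). (c * d, j)) m) t = c * comb m t" for m t
      by (induction m) (auto simp: comb_def algebra_simps)
    have a: "comb (m @ m') t = comb m t + comb m' t" for m m' t
      by (simp add: comb_def)
    have "comb (p # l) = (\<lambda>t. c * B j t + comb l t)"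
      by (simp add: comb_def p fun_eq_iff)
    moreover have "((\<lambda>t. c * B j t + comb l t) has_real_derivative c * comb (D j) t + comb l' t) (at t)" for t
      using assms by (intro DERIV_add DERIV_cmult l') (simp add: comb_def)
    ultimately show ?case
      by (intro exI[of _ "map (\<lambda>(d, j). (c * d, j)) (D j) @ l'"]) (simp only: a s, blast)
  qed
  then have "\<forall>g\<in>range comb. \<exists>g'\<in>range comb. \<forall>t. (g has_real_derivative g' t) (at t)"
    by blast
  moreover have "B i = comb [(1, i)]"
    by (simp add: comb_def fun_eq_iff)
  then have "B i \<in> range comb"
    by blast
  ultimately show ?thesis
    unfolding real_smooth_def by blast
qed

lemma real_smooth_flat_exp: "real_smooth (flat_exp k)"
  by (rule real_smooth_span[where B = flat_exp and D = "\<lambda>k. [(1, k + 2), (- real k, k + 1)]"])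
    (use flat_exp_has_derivative in simp)

lemma real_smooth_flat_log:
  assumes "a > 0"
  shows "real_smooth (flat_log a c k m)"
proof -
  have "real_smooth ((\<lambda>(k, m). flat_log a c k m) (k, m))"
    by (rule real_smooth_span[where B = "\<lambda>(k, m). flat_log a c k m" and
          D = "\<lambda>(k, m). [(a, k + 2, m + 1), (- a * real k, k + 1, m + 1), (- real m, k, m + 1)]"])
      (use flat_log_has_derivative[OF assms] in \<open>auto simp: algebra_simps\<close>)
  then show ?thesis by simp
qed

section \<open>Integration by parts for compactly supported functions in the plane\<close>

lemma integrable_continuous_compact_support:
  fixes f :: "complex \<Rightarrow> real"
  assumes "continuous_on UNIV f" "compact S" "\<And>z. z \<notin> S \<Longrightarrow> f z = 0"
  shows "integrable lborel f"
proof -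
  have "integrable lborel (\<lambda>x. indicator S x *\<^sub>R f x)"
    using assms by (intro borel_integrable_compact) (auto intro: continuous_on_subset)
  moreover have "(\<lambda>x. indicator S x *\<^sub>R f x) = f"
    using assms(3) by (auto simp: indicator_def fun_eq_iff)
  ultimately show ?thesis by simp
qed

lemma integral_lborel_translate:
  fixes f :: "'a::euclidean_space \<Rightarrow> real"
  assumes "f \<in> borel_measurable borel"
  shows "(\<integral>z. f (z + c) \<partial>lborel) = (\<integral>z. f z \<partial>lborel)"
proof -
  have "(\<integral>z. f z \<partial>lborel) = (\<integral>z. f z \<partial>(distr lborel borel ((+) c)))"
    by (simp add: lborel_distr_plus)
  also have "\<dots> = (\<integral>z. f (c + z) \<partial>lborel)"
    using assms by (subst integral_distr) auto
  finally show ?thesis by (simp add: add.commute)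
qed

text \<open>By translation invariance every difference quotient of \<open>f\<close> in direction
  \<open>e\<close> has integral 0; dominated convergence passes this on to the derivative.\<close>

lemma integral_directional_derivative_zero:
  fixes f f' :: "complex \<Rightarrow> real" and e :: complex
  assumes deriv: "\<And>z t. ((\<lambda>t. f (z + t *\<^sub>R e)) has_real_derivative f' (z + t *\<^sub>R e)) (at t)"
    and cont: "continuous_on UNIV f" "continuous_on UNIV f'"
    and S: "compact S" "\<And>z. z \<notin> S \<Longrightarrow> f z = 0" "\<And>z. z \<notin> S \<Longrightarrow> f' z = 0"
  shows "(\<integral>z. f' z \<partial>lborel) = 0"
proof -
  obtain R where R: "S \<subseteq> cball 0 R"
    using bounded_subset_ballD[OF compact_imp_bounded[OF S(1)], of 0] ball_subset_cball by blast
  have "bounded (f' ` S)"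
    using S(1) cont by (intro compact_imp_bounded compact_continuous_image) (auto intro: continuous_on_subset)
  then obtain B0 where "\<And>z. z \<in> S \<Longrightarrow> \<bar>f' z\<bar> \<le> B0"
    by (auto simp: bounded_iff)
  then have B: "\<bar>f' z\<bar> \<le> max B0 0" for z
    using S(3)[of z] by (cases "z \<in> S") (auto intro: max.coboundedI1)
  define B where "B = max B0 0"
  define s where "s n = inverse (real (Suc n))" for n
  have s: "s n > 0" "s n \<le> 1" for n
    by (simp_all add: s_def inverse_le_1_iff)
  have s0: "s \<longlonglongrightarrow> 0"
    unfolding s_def by (rule LIMSEQ_inverse_real_of_nat)
  define h where "h n z = (f (z + s n *\<^sub>R e) - f z) / s n" for n z
  have fint: "integrable lborel f"
    using cont(1) S(1,2) by (rule integrable_continuous_compact_support)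
  have fm: "f \<in> borel_measurable borel"
    using cont(1) by (rule borel_measurable_continuous_onI)
  have fm': "f' \<in> borel_measurable borel"
    using cont(2) by (rule borel_measurable_continuous_onI)
  have tint: "integrable lborel (\<lambda>z. f (z + c))" for c
  proof (rule integrable_continuous_compact_support)
    show "continuous_on UNIV (\<lambda>z. f (z + c))"
      by (rule continuous_on_compose2[OF cont(1)]) (auto intro!: continuous_intros)
    show "compact ((\<lambda>z. z - c) ` S)"
      using S(1) by (intro compact_continuous_image continuous_intros)
    show "f (z + c) = 0" if "z \<notin> (\<lambda>z. z - c) ` S" for z
      using that by (intro S(2)) (auto simp: image_iff)
  qed
  have "(\<integral>z. h n z \<partial>lborel) = 0" for n
    unfolding h_def using fint tint integral_lborel_translate[OF fm] by simp
  moreover have "(\<lambda>n. \<integral>z. h n z \<partial>lborel) \<longlonglongrightarrow> (\<integral>z. f' z \<partial>lborel)"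
  proof (rule integral_dominated_convergence)
    \<comment> \<open>The increments are at most 1, so outside the ball of radius
      \<open>R + cmod e\<close> both values in the quotient vanish; inside, the mean value theorem
      bounds it by \<open>B\<close>.\<close>
    show "integrable lborel (\<lambda>z::complex. B * indicator (cball 0 (R + cmod e)) z :: real)"
      by (intro integrable_mult_right integrable_real_indicator) (use emeasure_lborel_cball_finite[of "0::complex" "R + cmod e"] in auto)
    show "AE z in lborel. (\<lambda>n. h n z) \<longlonglongrightarrow> f' z"
    proof (rule AE_I2)
      fix z :: complex
      have "((\<lambda>t. (f (z + t *\<^sub>R e) - f z) / t) \<longlongrightarrow> f' z) (at 0)"
        using deriv[of z 0] by (simp add: has_field_derivative_iff)
      then show "(\<lambda>n. h n z) \<longlonglongrightarrow> f' z"
        unfolding h_def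
        by (rule filterlim_compose) (use s s0 in \<open>auto simp: filterlim_at less_imp_neq[symmetric]\<close>)
    qed
    show "AE z in lborel. norm (h n z) \<le> B * indicator (cball 0 (R + cmod e)) z" for n
    proof (rule AE_I2)
      fix z :: complex
      show "norm (h n z) \<le> B * indicator (cball 0 (R + cmod e)) z"
      proof (cases "z \<in> cball 0 (R + cmod e)")
        case True
        obtain t where t: "0 < t" "t < s n"
            "f (z + s n *\<^sub>R e) - f (z + 0 *\<^sub>R e) = (s n - 0) * f' (z + t *\<^sub>R e)"
          using MVT2[OF s(1)[of n], of "\<lambda>t. f (z + t *\<^sub>R e)" "\<lambda>t. f' (z + t *\<^sub>R e)"] deriv by auto
        then show ?thesis
          using True B[of "z + t *\<^sub>R e"] s(1)[of n] by (simp add: h_def B_def)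
      next
        case False
        have n: "cmod (s n *\<^sub>R e) \<le> cmod e"
          using s[of n] by (simp add: mult_left_le_one_le)
        have "cmod z \<le> cmod (z + s n *\<^sub>R e) + cmod (s n *\<^sub>R e)"
          by (metis add_diff_cancel_right' norm_triangle_ineq4)
        then have "\<not> cmod z \<le> R" "\<not> cmod (z + s n *\<^sub>R e) \<le> R"
          using False n norm_ge_zero[of e] by (simp_all only: mem_cball_0)
        then have "z \<notin> S" "z + s n *\<^sub>R e \<notin> S"
          using R by auto
        then show ?thesis using False S(2) by (simp add: h_def)
      qed
    qed
    show "h n \<in> borel_measurable lborel" for n
      unfolding h_def using fm by measurable
  qed (use fm' in simp)
  ultimately show ?thesis
    by (simp add: LIMSEQ_const_iff)
qed

lemma
  assumes "closed S" "\<And>z. z \<notin> S \<Longrightarrow> f z = 0" "z \<notin> S"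
  shows dx_outside_support: "dx f z = 0" and dy_outside_support: "dy f z = 0"
proof -
  have "((\<lambda>_. 0) has_derivative (\<lambda>_. 0)) (at z)" by simp
  then have "(f has_derivative (\<lambda>_. 0)) (at z)"
    by (rule has_derivative_transform_within_open[of _ _ _ _ "- S"]) (use assms in auto)
  from has_derivative_dx_dy[OF this] show "dx f z = 0" "dy f z = 0" by auto
qed

lemma smooth_fun_directional_derivative:
  assumes "smooth_fun f"
  shows "((\<lambda>t. f (z + t *\<^sub>R e)) has_real_derivative frechet_derivative f (at (z + t *\<^sub>R e)) e) (at t)"
proof -
  let ?D = "frechet_derivative f (at (z + t *\<^sub>R e))"
  have f: "(f has_derivative ?D) (at (z + t *\<^sub>R e))"
    using smooth_fun_differentiable[OF assms] by (simp add: frechet_derivative_works)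
  have "((\<lambda>t. z + t *\<^sub>R e) has_derivative (\<lambda>h. h *\<^sub>R e)) (at t)"
    by (auto intro!: derivative_eq_intros)
  from has_derivative_compose[OF this f]
  have "((\<lambda>t. f (z + t *\<^sub>R e)) has_derivative (\<lambda>h. ?D (h *\<^sub>R e))) (at t)" .
  moreover have "(\<lambda>h. ?D (h *\<^sub>R e)) = (*) (?D e)"
    using has_derivative_linear[OF f] by (auto simp: linear_cmul fun_eq_iff)
  ultimately show ?thesis
    by (simp add: has_field_derivative_def)
qed

lemma
  assumes "smooth_fun f" "compact S" "\<And>z. z \<notin> S \<Longrightarrow> f z = 0"
  shows integral_dx_zero: "(\<integral>z. dx f z \<partial>lborel) = 0"
    and integral_dy_zero: "(\<integral>z. dy f z \<partial>lborel) = 0"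
proof -
  note cl = compact_imp_closed[OF assms(2)]
  note c = smooth_fun_continuous[OF assms(1)]
  show "(\<integral>z. dx f z \<partial>lborel) = 0"
    using smooth_fun_directional_derivative[OF assms(1), of _ 1, folded dx_def]
    by (rule integral_directional_derivative_zero[OF _ c _ assms(2,3)])
      (auto intro: smooth_fun_continuous smooth_fun_dx assms(1) dx_outside_support[OF cl assms(3)])
  show "(\<integral>z. dy f z \<partial>lborel) = 0"
    using smooth_fun_directional_derivative[OF assms(1), of _ \<i>, folded dy_def]
    by (rule integral_directional_derivative_zero[OF _ c _ assms(2,3)])
      (auto intro: smooth_fun_continuous smooth_fun_dy assms(1) dy_outside_support[OF cl assms(3)])
qed

text \<open>Caccioppoli: the divergence of \<open>\<eta>\<^sup>2 v \<nabla>v\<close> absorbs all terms of \<open>|\<nabla>(\<eta> v)|\<^sup>2\<close>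
  except \<open>v\<^sup>2 |\<nabla>\<eta>|\<^sup>2 - \<eta>\<^sup>2 v \<Delta>v\<close>.\<close>

lemma caccioppoli_inequality:
  assumes \<eta>: "smooth_fun \<eta>" and v: "smooth_fun v"
    and S: "compact S" "\<And>z. z \<notin> S \<Longrightarrow> \<eta> z = 0"
    and sub: "\<And>z. z \<in> S \<Longrightarrow> 0 \<le> v z * (dx (dx v) z + dy (dy v) z)"
  shows "(\<integral>z. (dx (\<lambda>z. \<eta> z * v z) z)\<^sup>2 + (dy (\<lambda>z. \<eta> z * v z) z)\<^sup>2 \<partial>lborel)
     \<le> (\<integral>z. (v z)\<^sup>2 * ((dx \<eta> z)\<^sup>2 + (dy \<eta> z)\<^sup>2) \<partial>lborel)"
proof -
  define P where "P = (\<lambda>z. \<eta> z * \<eta> z * (v z * dx v z))"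
  define Q where "Q = (\<lambda>z. \<eta> z * \<eta> z * (v z * dy v z))"
  define G where "G = (\<lambda>z. (v z)\<^sup>2 * ((dx \<eta> z)\<^sup>2 + (dy \<eta> z)\<^sup>2))"
  define F where "F = (\<lambda>z. (dx (\<lambda>z. \<eta> z * v z) z)\<^sup>2 + (dy (\<lambda>z. \<eta> z * v z) z)\<^sup>2)"
  note sm = \<eta> v smooth_fun_dx smooth_fun_dy smooth_fun_add smooth_fun_mult smooth_fun_power
  have smP: "smooth_fun P" "smooth_fun Q" unfolding P_def Q_def by (intro sm)+
  have smG: "smooth_fun G" "smooth_fun F" unfolding G_def F_def by (intro sm)+
  note diff = smooth_fun_differentiable
  note cl = compact_imp_closed[OF S(1)]
  have off: "dx \<eta> z = 0" "dy \<eta> z = 0" if "z \<notin> S" for z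
    using dx_outside_support[OF cl S(2) that] dy_outside_support[OF cl S(2) that] by auto
  have offPQ: "P z = 0" "Q z = 0" if "z \<notin> S" for z
    using S(2)[OF that] by (auto simp: P_def Q_def)
  have offF: "F z = 0" "G z = 0" if "z \<notin> S" for z
    using that off S(2) by (auto simp: F_def G_def dx_mult dy_mult diff \<eta> v)
  have dP: "dx P z = \<eta> z * \<eta> z * (v z * dx (dx v) z + dx v z * dx v z) + (\<eta> z * dx \<eta> z + dx \<eta> z * \<eta> z) * (v z * dx v z)" for z
    unfolding P_def by (simp add: dx_mult diff sm)
  have dQ: "dy Q z = \<eta> z * \<eta> z * (v z * dy (dy v) z + dy v z * dy v z) + (\<eta> z * dy \<eta> z + dy \<eta> z * \<eta> z) * (v z * dy v z)" for z
    unfolding Q_def by (simp add: dy_mult diff sm)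
  have le: "F z \<le> G z + (dx P z + dy Q z)" for z
  proof (cases "z \<in> S")
    case True
    have "F z = G z + (dx P z + dy Q z) - (\<eta> z)\<^sup>2 * (v z * (dx (dx v) z + dy (dy v) z))"
      unfolding F_def G_def dP dQ by (simp add: dx_mult dy_mult diff \<eta> v power2_eq_square algebra_simps)
    then show ?thesis using sub[OF True] by simp
  next
    case False
    then show ?thesis
      using offF[OF False] dx_outside_support[OF cl offPQ(1) False] dy_outside_support[OF cl offPQ(2) False]
      by simp
  qed
  note int = integrable_continuous_compact_support[OF smooth_fun_continuous S(1)]
  have i: "integrable lborel F" "integrable lborel G" "integrable lborel (dx P)" "integrable lborel (dy Q)"
    using smG smP offF dx_outside_support[OF cl offPQ(1)] dy_outside_support[OF cl offPQ(2)]
    by (auto intro!: int smooth_fun_dx smooth_fun_dy)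
  have "(\<integral>z. F z \<partial>lborel) \<le> (\<integral>z. G z + (dx P z + dy Q z) \<partial>lborel)"
    using i le by (intro integral_mono) auto
  also have "\<dots> = (\<integral>z. G z \<partial>lborel)"
    using i integral_dx_zero[OF smP(1) S(1) offPQ(1)] integral_dy_zero[OF smP(2) S(1) offPQ(2)] by simp
  finally show ?thesis unfolding F_def G_def .
qed

section \<open>Logarithmic means over discs\<close>

lemma measure_cball_complex: "0 \<le> r \<Longrightarrow> measure lborel (cball (z::complex) r) = pi * r\<^sup>2"
  by (simp add: content_cball unit_ball_vol_2)

lemma emeasure_ball_complex: "0 \<le> r \<Longrightarrow> emeasure lborel (ball (z::complex) r) = ennreal (pi * r\<^sup>2)"
  by (simp add: emeasure_ball unit_ball_vol_2)

text \<open>The positive part confines the logarithmic pole to the disc of radius \<open>s\<close>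
  about \<open>w\<close>. At \<open>w\<close> itself the default values of division and
  \<open>ln\<close> give 0, which affects only a null set.\<close>

definition log_well :: "real \<Rightarrow> complex \<Rightarrow> complex \<Rightarrow> real" where
  "log_well s w \<zeta> = max 0 (ln (s / cmod (\<zeta> - w)))"

lemma log_well_measurable [measurable]: "log_well s w \<in> borel_measurable borel"
  unfolding log_well_def by measurable

text \<open>Layer-cake formula: the well exceeds \<open>t\<close> on a punctured disc of radius
  \<open>s * exp (- t)\<close>, and the areas integrate to half of \<open>pi * s ^ 2\<close>. This
  factor 1/2 is the exponent in the threshold \<open>exp (-1/2)\<close>.\<close>

lemma nn_integral_log_well:
  assumes s: "0 < s"
  shows "(\<integral>\<^sup>+\<zeta>. ennreal (log_well s w \<zeta>) \<partial>lborel) \<le> ennreal (pi * s\<^sup>2 / 2)"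
proof -
  define F :: "complex \<Rightarrow> real \<Rightarrow> ennreal" where
    "F \<zeta> t = (if 0 \<le> t \<and> cmod (\<zeta> - w) < s * exp (- t) then 1 else 0)" for \<zeta> t
  have [measurable]: "(\<lambda>p. F (fst p) (snd p)) \<in> borel_measurable (lborel \<Otimes>\<^sub>M lborel)"
    unfolding F_def by measurable
  have m': "(\<lambda>p. F (snd p) (fst p)) \<in> borel_measurable (lborel \<Otimes>\<^sub>M lborel)"
    unfolding F_def by measurable
  have "ennreal (log_well s w \<zeta>) \<le> (\<integral>\<^sup>+t. F \<zeta> t \<partial>lborel)" for \<zeta>
  proof (cases "\<zeta> = w")
    case True
    then show ?thesis by (simp add: log_well_def)
  next
    case False
    let ?L = "log_well s w \<zeta>"
    have "ennreal ?L = emeasure lborel {0..<?L}"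
      by (simp add: log_well_def)
    also have "\<dots> = (\<integral>\<^sup>+t. indicator {0..<?L} t \<partial>lborel)"
      by simp
    also have "\<dots> \<le> (\<integral>\<^sup>+t. F \<zeta> t \<partial>lborel)"
    proof (rule nn_integral_mono)
      fix t
      show "indicator {0..<?L} t \<le> F \<zeta> t"
      proof (cases "t \<in> {0..<?L}")
        case True
        then have "t < ln (s / cmod (\<zeta> - w))" by (auto simp: log_well_def max_def split: if_splits)
        moreover have "0 < s / cmod (\<zeta> - w)" using False s by simp
        ultimately have "exp t < s / cmod (\<zeta> - w)"
          by (metis exp_less_cancel_iff exp_ln)
        then have "cmod (\<zeta> - w) < s * exp (- t)"
          using False by (simp add: field_simps exp_minus)
        then show ?thesis using True by (simp add: F_def)
      qed simp
    qed
    finally show ?thesis .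
  qed
  then have "(\<integral>\<^sup>+\<zeta>. ennreal (log_well s w \<zeta>) \<partial>lborel) \<le> (\<integral>\<^sup>+\<zeta>. \<integral>\<^sup>+t. F \<zeta> t \<partial>lborel \<partial>lborel)"
    by (intro nn_integral_mono)
  also have "\<dots> = (\<integral>\<^sup>+t. \<integral>\<^sup>+\<zeta>. F \<zeta> t \<partial>lborel \<partial>lborel)"
    using lborel_pair.Fubini'[of F] by (simp add: case_prod_beta')
  also have "\<dots> = (\<integral>\<^sup>+t. ennreal (pi * s\<^sup>2 * exp (- 2 * t)) * indicator {0..} t \<partial>lborel)"
  proof (rule nn_integral_cong)
    fix t :: real
    show "(\<integral>\<^sup>+\<zeta>. F \<zeta> t \<partial>lborel) = ennreal (pi * s\<^sup>2 * exp (- 2 * t)) * indicator {0..} t"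
    proof (cases "0 \<le> t")
      case True
      have "(\<integral>\<^sup>+\<zeta>. F \<zeta> t \<partial>lborel) = (\<integral>\<^sup>+\<zeta>. indicator (ball w (s * exp (- t))) \<zeta> \<partial>lborel)"
        using True by (intro nn_integral_cong) (auto simp: F_def indicator_def dist_norm norm_minus_commute)
      also have "\<dots> = ennreal (pi * (s * exp (- t))\<^sup>2)"
        using s by (simp add: emeasure_ball_complex)
      also have "(s * exp (- t))\<^sup>2 = s\<^sup>2 * exp (- 2 * t)"
        by (simp add: power_mult_distrib flip: exp_double)
      finally show ?thesis using True by (simp add: mult.assoc)
    qed (simp add: F_def)
  qed
  also have "\<dots> = ennreal (0 - (- (pi * s\<^sup>2 / 2) * exp (- 2 * 0)))"
  proof (rule nn_integral_FTC_atLeast)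
    show "((\<lambda>t. - (pi * s\<^sup>2 / 2) * exp (- 2 * t)) has_real_derivative pi * s\<^sup>2 * exp (- 2 * t)) (at t)" for t
      by (auto intro!: derivative_eq_intros)
    have "((\<lambda>t::real. exp (- 2 * t)) \<longlongrightarrow> 0) at_top"
      by (rule filterlim_compose[OF exp_at_bot]) (rule filterlim_tendsto_neg_mult_at_bot[OF tendsto_const _ filterlim_ident], simp)
    then show "((\<lambda>t. - (pi * s\<^sup>2 / 2) * exp (- 2 * t)) \<longlongrightarrow> 0) at_top"
      by (rule tendsto_mult_right_zero)
  qed auto
  finally show ?thesis by simp
qed

lemma
  assumes s: "0 < s"
  shows integrable_log_well: "integrable lborel (log_well s w)"
    and integral_log_well: "(\<integral>\<zeta>. log_well s w \<zeta> \<partial>lborel) \<le> pi * s\<^sup>2 / 2"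
proof -
  have nn: "0 \<le> log_well s w \<zeta>" for \<zeta> by (simp add: log_well_def)
  show i: "integrable lborel (log_well s w)"
    using nn_integral_log_well[OF s, of w] nn
    by (intro integrableI_bounded) (auto simp: le_less_trans)
  have "ennreal (\<integral>\<zeta>. log_well s w \<zeta> \<partial>lborel) \<le> ennreal (pi * s\<^sup>2 / 2)"
    using nn_integral_log_well[OF s, of w] nn i by (subst (asm) nn_integral_eq_integral) auto
  then show "(\<integral>\<zeta>. log_well s w \<zeta> \<partial>lborel) \<le> pi * s\<^sup>2 / 2"
    by (simp add: ennreal_le_iff)
qed

text \<open>The mean of \<open>ln |\<zeta> - w|\<close> over any disc of radius \<open>s\<close> is smallest when the disc is centred
  at \<open>w\<close>.\<close>

lemma
  assumes s: "0 < s"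
  shows set_integrable_ln_dist: "set_integrable lborel (cball z s) (\<lambda>\<zeta>. ln (cmod (\<zeta> - w)))"
    and set_integral_ln_dist_ge:
      "pi * s\<^sup>2 * (ln s - 1 / 2) \<le> (LINT \<zeta>:cball z s|lborel. ln (cmod (\<zeta> - w)))"
proof -
  let ?D = "cball z s"
  let ?N = "log_well s w"
  define \<rho> where "\<rho> = s + cmod (z - w)"
  have \<rho>: "0 < \<rho>" using s by (simp add: \<rho>_def add_pos_nonneg)
  have lower: "ln s - ?N \<zeta> \<le> ln (cmod (\<zeta> - w))" if "\<zeta> \<noteq> w" for \<zeta>
    using that s by (simp add: log_well_def ln_div)
  have upper: "ln (cmod (\<zeta> - w)) \<le> ln \<rho>" if "\<zeta> \<noteq> w" "\<zeta> \<in> ?D" for \<zeta>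
  proof -
    have "cmod (\<zeta> - w) \<le> cmod (\<zeta> - z) + cmod (z - w)"
      using norm_triangle_ineq[of "\<zeta> - z" "z - w"] by simp
    then have "cmod (\<zeta> - w) \<le> \<rho>" using that(2) by (simp add: \<rho>_def dist_norm norm_minus_commute)
    then show ?thesis using that(1) \<rho> by simp
  qed
  have aw: "AE \<zeta> in lborel. \<zeta> \<noteq> w"
    by (rule AE_lborel_singleton)
  have iD: "integrable lborel (\<lambda>\<zeta>. c * indicator ?D \<zeta> :: real)" for c
    using emeasure_lborel_cball_finite[of z s]
    by (intro integrable_mult_right integrable_real_indicator) auto
  note iN = integrable_log_well[OF s, of w]
  have [measurable]: "?D \<in> sets borel" "(\<lambda>\<zeta>. ln (cmod (\<zeta> - w))) \<in> borel_measurable borel"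
    by auto
  show i: "set_integrable lborel ?D (\<lambda>\<zeta>. ln (cmod (\<zeta> - w)))"
    unfolding set_integrable_def
  proof (rule Bochner_Integration.integrable_bound)
    show "integrable lborel (\<lambda>\<zeta>. ?N \<zeta> + (\<bar>ln s\<bar> + \<bar>ln \<rho>\<bar>) * indicator ?D \<zeta>)"
      by (intro Bochner_Integration.integrable_add iN iD)
    show "AE \<zeta> in lborel. norm (indicator ?D \<zeta> *\<^sub>R ln (cmod (\<zeta> - w)))
        \<le> norm (?N \<zeta> + (\<bar>ln s\<bar> + \<bar>ln \<rho>\<bar>) * indicator ?D \<zeta>)"
      using aw
    proof eventually_elim
      case (elim \<zeta>)
      have "0 \<le> ?N \<zeta>" by (simp add: log_well_def)
      then show ?case using lower[OF elim] upper[OF elim] by (cases "\<zeta> \<in> ?D") auto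
    qed
  qed measurable
  have "pi * s\<^sup>2 * (ln s - 1 / 2) = ln s * measure lborel ?D - pi * s\<^sup>2 / 2"
    using s by (simp add: measure_cball_complex algebra_simps)
  also have "\<dots> \<le> (\<integral>\<zeta>. ln s * indicator ?D \<zeta> \<partial>lborel) - (\<integral>\<zeta>. ?N \<zeta> \<partial>lborel)"
    using integral_log_well[OF s, of w] emeasure_lborel_cball_finite[of z s] by simp
  also have "\<dots> = (\<integral>\<zeta>. ln s * indicator ?D \<zeta> - ?N \<zeta> \<partial>lborel)"
    by (rule Bochner_Integration.integral_diff[OF iD iN, symmetric])
  \<comment> \<open>Outside the disc the left integrand is minus the well, hence at most 0.
    Integrating the well over the whole plane makes the bound independent of the position of
    \<open>w\<close>.\<close>
  also have "\<dots> \<le> (\<integral>\<zeta>. indicator ?D \<zeta> *\<^sub>R ln (cmod (\<zeta> - w)) \<partial>lborel)"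
  proof (rule integral_mono_AE)
    show "AE \<zeta> in lborel. ln s * indicator ?D \<zeta> - ?N \<zeta> \<le> indicator ?D \<zeta> *\<^sub>R ln (cmod (\<zeta> - w))"
      using aw
    proof eventually_elim
      case (elim \<zeta>)
      have "0 \<le> ?N \<zeta>" by (simp add: log_well_def)
      then show ?case using lower[OF elim] by (cases "\<zeta> \<in> ?D") auto
    qed
  qed (use i iD iN in \<open>auto simp: set_integrable_def\<close>)
  finally show "pi * s\<^sup>2 * (ln s - 1 / 2) \<le> (LINT \<zeta>:?D|lborel. ln (cmod (\<zeta> - w)))"
    by (simp add: set_lebesgue_integral_def)
qed

section \<open>The test function\<close>

text \<open>The identity below says that \<open>ln A\<close> is harmonic where \<open>A\<close> does not vanish, stated so that
  it also makes sense at the zeros of \<open>A\<close>.\<close>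

definition log_harmonic :: "(complex \<Rightarrow> real) \<Rightarrow> bool" where
  "log_harmonic A \<longleftrightarrow> smooth_fun A \<and>
     (\<forall>z. (dx A z)\<^sup>2 + (dy A z)\<^sup>2 = A z * (dx (dx A) z + dy (dy A) z))"

lemma dx_const: "dx (\<lambda>z. c) = (\<lambda>z. 0)" and dy_const: "dy (\<lambda>z. c) = (\<lambda>z. 0)"
  using has_derivative_dx_dy[OF has_derivative_const] by auto

text \<open>This reflects that the logarithm of a product is a sum. The cross terms
  \<open>2 A B (grad A . grad B)\<close> agree on both sides, so no division by \<open>A\<close> or
  \<open>B\<close> occurs.\<close>

lemma log_harmonic_mult:
  assumes "log_harmonic A" "log_harmonic B"
  shows "log_harmonic (\<lambda>z. A z * B z)"
proof -
  have sm: "smooth_fun A" "smooth_fun B" using assms by (auto simp: log_harmonic_def)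
  note d = smooth_fun_differentiable smooth_fun_dx smooth_fun_dy smooth_fun_mult sm
  have x: "dx (\<lambda>z. A z * B z) = (\<lambda>z. A z * dx B z + dx A z * B z)"
    and y: "dy (\<lambda>z. A z * B z) = (\<lambda>z. A z * dy B z + dy A z * B z)"
    by (auto simp: dx_mult dy_mult d)
  have xx: "dx (dx (\<lambda>z. A z * B z)) z = A z * dx (dx B) z + 2 * (dx A z * dx B z) + dx (dx A) z * B z" for z
    unfolding x by (simp add: dx_mult dx_add d)
  have yy: "dy (dy (\<lambda>z. A z * B z)) z = A z * dy (dy B) z + 2 * (dy A z * dy B z) + dy (dy A) z * B z" for z
    unfolding y by (simp add: dy_mult dy_add d)
  have "(dx (\<lambda>z. A z * B z) z)\<^sup>2 + (dy (\<lambda>z. A z * B z) z)\<^sup>2 =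
      A z * B z * (dx (dx (\<lambda>z. A z * B z)) z + dy (dy (\<lambda>z. A z * B z)) z)" for z
  proof -
    have "(dx A z)\<^sup>2 + (dy A z)\<^sup>2 = A z * (dx (dx A) z + dy (dy A) z)"
      "(dx B z)\<^sup>2 + (dy B z)\<^sup>2 = B z * (dx (dx B) z + dy (dy B) z)"
      using assms by (auto simp: log_harmonic_def)
    then show ?thesis unfolding xx yy unfolding x y by algebra
  qed
  then show ?thesis by (simp add: log_harmonic_def smooth_fun_mult sm)
qed

lemma
  shows smooth_fun_dist_sq: "smooth_fun (\<lambda>z. (cmod (z - w))\<^sup>2)"
    and dx_dist_sq: "dx (\<lambda>z. (cmod (z - w))\<^sup>2) = (\<lambda>z. 2 * Re (z - w))"
    and dy_dist_sq: "dy (\<lambda>z. (cmod (z - w))\<^sup>2) = (\<lambda>z. 2 * Im (z - w))"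
proof -
  have eq: "(\<lambda>z. (cmod (z - w))\<^sup>2) = (\<lambda>z. (Re z + (- Re w))\<^sup>2 + (Im z + (- Im w))\<^sup>2)"
    by (simp add: cmod_power2)
  show "smooth_fun (\<lambda>z. (cmod (z - w))\<^sup>2)"
    unfolding eq
    by (intro smooth_fun_add smooth_fun_power smooth_fun_const smooth_fun_bounded_linear
        bounded_linear_Re bounded_linear_Im)
  have "((\<lambda>z. (Re z + (- Re w))\<^sup>2 + (Im z + (- Im w))\<^sup>2) has_derivative
      (\<lambda>h. 2 * Re (z - w) * Re h + 2 * Im (z - w) * Im h)) (at z)" for z
    by (auto intro!: derivative_eq_intros simp: algebra_simps)
  from has_derivative_dx_dy[OF this]
  show "dx (\<lambda>z. (cmod (z - w))\<^sup>2) = (\<lambda>z. 2 * Re (z - w))"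
    "dy (\<lambda>z. (cmod (z - w))\<^sup>2) = (\<lambda>z. 2 * Im (z - w))"
    unfolding eq by auto
qed

text \<open>The square is taken because the modulus is not differentiable at \<open>w\<close>. Its
  gradient has squared length 4 times the function, and its Laplacian is 4.\<close>

lemma log_harmonic_dist_sq: "log_harmonic (\<lambda>z. (cmod (z - w))\<^sup>2)"
proof -
  have "((\<lambda>z. 2 * Re (z - w)) has_derivative (\<lambda>h. 2 * Re h)) (at z)"
    "((\<lambda>z. 2 * Im (z - w)) has_derivative (\<lambda>h. 2 * Im h)) (at z)" for z
    by (auto intro!: derivative_eq_intros)
  from has_derivative_dx_dy(1)[OF this(1)] has_derivative_dx_dy(2)[OF this(2)]
  have "dx (\<lambda>z. 2 * Re (z - w)) = (\<lambda>z. 2)" "dy (\<lambda>z. 2 * Im (z - w)) = (\<lambda>z. 2)" by auto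
  moreover have "(2 * p)\<^sup>2 + (2 * q)\<^sup>2 = (p\<^sup>2 + q\<^sup>2) * (2 + 2)" for p q :: real
    by (simp add: power2_eq_square algebra_simps)
  ultimately show ?thesis
    unfolding log_harmonic_def dx_dist_sq dy_dist_sq using smooth_fun_dist_sq
    by (simp only: cmod_power2) simp
qed

lemma log_harmonic_prod: "log_harmonic (\<lambda>z. \<Prod>j<(n::nat). (cmod (z - x j))\<^sup>2)"
proof (induction n)
  case 0
  show ?case by (simp add: log_harmonic_def smooth_fun_const dx_const dy_const)
next
  case (Suc n)
  from log_harmonic_mult[OF Suc log_harmonic_dist_sq[of "x n"]] show ?case by simp
qed

text \<open>\<open>exp (-1/y)\<close> is convex for \<open>y \<le> 1/2\<close>.\<close>

lemma flat_log_subharmonic: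
  assumes A: "log_harmonic A" and a: "0 < a" and y: "a * ln (A z) - c \<le> 1 / 2"
  defines "v \<equiv> \<lambda>z. flat_log a c 0 0 (A z)"
  shows "0 \<le> v z * (dx (dx v) z + dy (dy v) z)"
proof (cases "A z > 0")
  case False
  then show ?thesis by (simp add: v_def flat_log_def)
next
  case True
  have smA: "smooth_fun A" using A by (simp add: log_harmonic_def)
  define h1 where "h1 t = a * flat_log a c 2 1 t" for t
  define h2 where "h2 t = a * (a * flat_log a c 4 2 t - 2 * a * flat_log a c 3 2 t - flat_log a c 2 2 t)" for t
  have d1: "(flat_log a c 0 0 has_real_derivative h1 t) (at t)" for t
    using flat_log_has_derivative[OF a, of c 0 0 t] by (simp add: h1_def numeral_eq_Suc)
  have d2: "(h1 has_real_derivative h2 t) (at t)" for t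
    using DERIV_cmult[OF flat_log_has_derivative[OF a, of c 2 1 t], of a]
    unfolding h1_def h2_def by (simp add: numeral_eq_Suc algebra_simps)
  note df = smooth_fun_differentiable
  have x: "dx v = (\<lambda>z. h1 (A z) * dx A z)" and y': "dy v = (\<lambda>z. h1 (A z) * dy A z)"
    unfolding v_def using dx_comp[OF d1 df[OF smA]] dy_comp[OF d1 df[OF smA]] by auto
  note dh = differentiable_comp_real[OF d2 df[OF smA]]
  have "dx (dx v) z = h1 (A z) * dx (dx A) z + h2 (A z) * dx A z * dx A z"
    unfolding x using dx_mult[OF dh df[OF smooth_fun_dx[OF smA]]] dx_comp[OF d2 df[OF smA]] by simp
  moreover have "dy (dy v) z = h1 (A z) * dy (dy A) z + h2 (A z) * dy A z * dy A z"
    unfolding y' using dy_mult[OF dh df[OF smooth_fun_dy[OF smA]]] dy_comp[OF d2 df[OF smA]] by simp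
  ultimately have "dx (dx v) z + dy (dy v) z
      = h1 (A z) * (dx (dx A) z + dy (dy A) z) + h2 (A z) * ((dx A z)\<^sup>2 + (dy A z)\<^sup>2)"
    by (simp add: power2_eq_square algebra_simps)
  \<comment> \<open>The identity for \<open>A\<close> turns the squared gradient into
    \<open>A\<close> times the Laplacian, so the latter becomes a common factor.\<close>
  also have "\<dots> = (h1 (A z) + A z * h2 (A z)) * (dx (dx A) z + dy (dy A) z)"
    using A by (simp add: log_harmonic_def algebra_simps)
  finally have lap: "dx (dx v) z + dy (dy v) z = (h1 (A z) + A z * h2 (A z)) * (dx (dx A) z + dy (dy A) z)" .
  have "0 \<le> A z * (dx (dx A) z + dy (dy A) z)"
    using A by (metis log_harmonic_def sum_power2_ge_zero)
  then have "0 \<le> dx (dx A) z + dy (dy A) z"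
    using True by (simp add: zero_le_mult_iff)
  moreover have "0 \<le> h1 (A z) + A z * h2 (A z)"
  proof -
    let ?y = "a * ln (A z) - c"
    \<comment> \<open>This is the second derivative of \<open>flat_exp 0\<close>; its sign for
      positive \<open>u\<close> is that of \<open>1 - 2 * u\<close>.\<close>
    have "flat_exp 4 u - 2 * flat_exp 3 u = (if u \<le> 0 then 0 else exp (- (1 / u)) / u ^ 4 * (1 - 2 * u))" for u
      by (simp add: flat_exp_def field_simps power_numeral_reduce)
    then have "0 \<le> flat_exp 4 ?y - 2 * flat_exp 3 ?y" using y by simp
    moreover have "h1 (A z) + A z * h2 (A z) = a\<^sup>2 / A z * (flat_exp 4 ?y - 2 * flat_exp 3 ?y)"
      using True by (simp add: h1_def h2_def flat_log_def power2_eq_square field_simps)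
    ultimately show ?thesis using True by simp
  qed
  moreover have "0 \<le> v z" by (simp add: v_def flat_log_def flat_exp_nonneg)
  ultimately show ?thesis unfolding lap by simp
qed

text \<open>The constant 16 is the product of the square of the bound 2 for
  \<open>flat_exp 2\<close> and the bound \<open>4 / s ^ 2\<close> for the squared gradient of the
  quadratic argument on the disc.\<close>

lemma disc_cutoff:
  fixes z :: complex
  assumes s: "0 < s"
  defines "\<eta> \<equiv> \<lambda>\<zeta>. flat_exp 0 (1 - (cmod (\<zeta> - z))\<^sup>2 / s\<^sup>2)"
  shows "smooth_fun \<eta>" and "\<And>\<zeta>. \<zeta> \<notin> cball z s \<Longrightarrow> \<eta> \<zeta> = 0"
    and "\<And>\<zeta>. (dx \<eta> \<zeta>)\<^sup>2 + (dy \<eta> \<zeta>)\<^sup>2 \<le> 16 / s\<^sup>2 * indicator (cball z s) \<zeta>"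
proof -
  define w where "w \<zeta> = 1 + (- (1 / s\<^sup>2)) * (cmod (\<zeta> - z))\<^sup>2" for \<zeta>
  have \<eta>: "\<eta> = (\<lambda>\<zeta>. flat_exp 0 (w \<zeta>))" by (simp add: \<eta>_def w_def)
  have smw: "smooth_fun w"
    unfolding w_def by (intro smooth_fun_add smooth_fun_mult smooth_fun_const smooth_fun_dist_sq)
  then show "smooth_fun \<eta>"
    unfolding \<eta> by (rule smooth_fun_comp[OF real_smooth_flat_exp])
  have w0: "w \<zeta> < 0" if "\<zeta> \<notin> cball z s" for \<zeta>
  proof -
    have "s < cmod (\<zeta> - z)" using that by (simp add: dist_norm norm_minus_commute)
    then have "s\<^sup>2 < (cmod (\<zeta> - z))\<^sup>2" using s by (intro power_strict_mono) auto
    then show ?thesis using s by (simp add: w_def)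
  qed
  then show off: "\<eta> \<zeta> = 0" if "\<zeta> \<notin> cball z s" for \<zeta>
    using that by (simp add: \<eta> flat_exp_def less_imp_le)
  fix \<zeta>
  note df = smooth_fun_differentiable
  have E: "(flat_exp 0 has_real_derivative flat_exp 2 t) (at t)" for t
    using flat_exp_has_derivative[of 0 t] by (simp add: numeral_eq_Suc)
  have aff: "((\<lambda>t. 1 + r * t) has_real_derivative r) (at t)" for r t :: real
    by (auto intro!: derivative_eq_intros)
  have dw: "dx w \<zeta> = - (1 / s\<^sup>2) * (2 * Re (\<zeta> - z))" "dy w \<zeta> = - (1 / s\<^sup>2) * (2 * Im (\<zeta> - z))"
    unfolding w_def dx_comp[OF aff df[OF smooth_fun_dist_sq]] dy_comp[OF aff df[OF smooth_fun_dist_sq]]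
      dx_dist_sq dy_dist_sq by (rule refl)+
  have alg: "(e * (- (1 / s\<^sup>2) * (2 * p)))\<^sup>2 + (e * (- (1 / s\<^sup>2) * (2 * q)))\<^sup>2 = e\<^sup>2 * (4 * (p\<^sup>2 + q\<^sup>2) / s ^ 4)" for e p q
    using s by (simp add: field_simps power_numeral_reduce power2_eq_square)
  have "(dx \<eta> \<zeta>)\<^sup>2 + (dy \<eta> \<zeta>)\<^sup>2 = (flat_exp 2 (w \<zeta>))\<^sup>2 * (4 * (cmod (\<zeta> - z))\<^sup>2 / s ^ 4)"
    unfolding \<eta> dx_comp[OF E df[OF smw]] dy_comp[OF E df[OF smw]] dw alg
    by (simp only: cmod_power2 minus_complex.sel)
  also have "\<dots> \<le> 16 / s\<^sup>2 * indicator (cball z s) \<zeta>"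
  proof (cases "\<zeta> \<in> cball z s")
    case True
    then have le: "cmod (\<zeta> - z) \<le> s" by (simp add: dist_norm norm_minus_commute)
    then have "(cmod (\<zeta> - z))\<^sup>2 \<le> s\<^sup>2" by (intro power_mono) auto
    then have sq: "4 * (cmod (\<zeta> - z))\<^sup>2 / s ^ 4 \<le> 4 / s\<^sup>2"
      using s by (simp add: field_simps power_numeral_reduce)
    have "0 \<le> w \<zeta>" using \<open>(cmod (\<zeta> - z))\<^sup>2 \<le> s\<^sup>2\<close> s by (simp add: w_def)
    then have "flat_exp 2 (w \<zeta>) \<le> 2" using flat_exp_le[of "w \<zeta>" 2 0] by simp
    then have "(flat_exp 2 (w \<zeta>))\<^sup>2 \<le> 2\<^sup>2" using flat_exp_nonneg by (intro power_mono)
    then have "(flat_exp 2 (w \<zeta>))\<^sup>2 * (4 * (cmod (\<zeta> - z))\<^sup>2 / s ^ 4) \<le> 2\<^sup>2 * (4 / s\<^sup>2)"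
      using sq s by (intro mult_mono) auto
    then show ?thesis using True by simp
  next
    case False
    then show ?thesis using w0[OF False] by (simp add: flat_exp_def)
  qed
  finally show "(dx \<eta> \<zeta>)\<^sup>2 + (dy \<eta> \<zeta>)\<^sup>2 \<le> 16 / s\<^sup>2 * indicator (cball z s) \<zeta>" .
qed

text \<open>The mean of \<open>U\<close> over the disc is at least \<open>c0\<close>, while
  \<open>U\<close> is at most \<open>M\<close>. Points with \<open>U\<close> at most
  \<open>c0 / 4\<close> contribute at most \<open>c0 / 4\<close> to the mean and the outer annulus
  at most \<open>c0 / 2\<close>; the remaining \<open>c0 / 4\<close> must come from
  \<open>S\<close>. The annulus is discarded because the cut-off is bounded below only on the
  smaller disc, and the zeros \<open>x j\<close> because \<open>ln 0\<close> is a mere default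
  value.\<close>

lemma large_potential_region:
  fixes z :: complex and x :: "nat \<Rightarrow> complex"
  assumes s: "0 < s" and n: "0 < n" and x: "\<And>j. x j \<in> cball z s"
    and \<beta>: "0 < \<beta>" and c0: "c0 = - ln \<beta> - 1 / 2" "0 < c0" and M: "M = ln 2 - ln \<beta>"
    and \<delta>: "\<delta> = c0 / (4 * M)"
  defines "U \<equiv> \<lambda>\<zeta>. (\<Sum>j<n. ln (cmod (\<zeta> - x j))) / real n - ln (\<beta> * s)"
  defines "S \<equiv> {\<zeta> \<in> cball z ((1 - \<delta>) * s). c0 / 4 \<le> U \<zeta> \<and> (\<forall>j<n. \<zeta> \<noteq> x j)}"
  shows "S \<in> sets borel" and "pi * s\<^sup>2 * c0 / (4 * M) \<le> measure lborel S"
    and "\<And>\<zeta>. \<zeta> \<in> cball z s \<Longrightarrow> \<forall>j<n. \<zeta> \<noteq> x j \<Longrightarrow> U \<zeta> \<le> M"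
proof -
  let ?D = "cball z s" and ?D' = "cball z ((1 - \<delta>) * s)"
  have "(0::real) < ln 2" by simp
  then have Mc: "c0 < M" unfolding c0(1) M by linarith
  then have M0: "0 < M" using c0 by simp
  have \<delta>0: "0 < \<delta>" "\<delta> < 1" using M0 c0 Mc by (auto simp: \<delta> field_simps)
  show SU: "U \<zeta> \<le> M" if \<zeta>: "\<zeta> \<in> ?D" "\<forall>j<n. \<zeta> \<noteq> x j" for \<zeta>
  proof -
    have "ln (cmod (\<zeta> - x j)) \<le> ln (2 * s)" if "j < n" for j
    proof -
      have "dist \<zeta> (x j) \<le> dist \<zeta> z + dist z (x j)" by (rule dist_triangle)
      then have "cmod (\<zeta> - x j) \<le> 2 * s" using \<zeta>(1) x[of j] by (simp add: dist_norm norm_minus_commute)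
      then show ?thesis using \<zeta>(2) that by (intro ln_mono) auto
    qed
    then have "(\<Sum>j<n. ln (cmod (\<zeta> - x j))) \<le> (\<Sum>j<n. ln (2 * s))" by (intro sum_mono) auto
    then have "(\<Sum>j<n. ln (cmod (\<zeta> - x j))) / real n \<le> ln (2 * s)"
      using n by (simp add: divide_le_eq mult.commute)
    then show ?thesis using s \<beta> by (simp add: U_def M ln_mult)
  qed
  have Um [measurable]: "U \<in> borel_measurable borel" unfolding U_def by measurable
  have Dm [measurable]: "?D \<in> sets borel" "?D' \<in> sets borel" by auto
  show Sm [measurable]: "S \<in> sets borel"
  proof -
    have "S = ?D' \<inter> {\<zeta> \<in> space borel. c0 / 4 \<le> U \<zeta>} - x ` {..<n}" by (auto simp: S_def)
    also have "\<dots> \<in> sets borel"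
    proof (intro sets.Diff sets.Int Dm)
      show "{\<zeta> \<in> space borel. c0 / 4 \<le> U \<zeta>} \<in> sets borel" by measurable
      show "x ` {..<n} \<in> sets borel" by (intro borel_closed finite_imp_closed) auto
    qed
    finally show ?thesis .
  qed
  have fin: "emeasure lborel A < \<infinity>" if "A \<subseteq> ?D" "A \<in> sets borel" for A
    using emeasure_mono[OF that(1), of lborel] emeasure_lborel_cball_finite[of z s] by (auto intro: le_less_trans)
  have D'D: "?D' \<subseteq> ?D" using s \<delta>0 by (intro subset_cball) (simp add: mult_left_le_one_le algebra_simps)
  have iD: "integrable lborel (\<lambda>\<zeta>. r * indicator A \<zeta> :: real)" if "A \<subseteq> ?D" "A \<in> sets borel" for A r
    using fin[OF that] that by (intro integrable_mult_right integrable_real_indicator) auto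
  have mD: "measure lborel ?D = pi * s\<^sup>2" using s by (simp add: measure_cball_complex)
  have mD': "measure lborel ?D' = pi * ((1 - \<delta>) * s)\<^sup>2" using s \<delta>0 by (subst measure_cball_complex) auto
  note li = set_integrable_ln_dist[OF s, of z, unfolded set_integrable_def]
  note ge = set_integral_ln_dist_ge[OF s, of z, unfolded set_lebesgue_integral_def]
  have eqU: "indicator ?D \<zeta> *\<^sub>R U \<zeta> = (\<Sum>j<n. indicator ?D \<zeta> *\<^sub>R ln (cmod (\<zeta> - x j))) / real n - ln (\<beta> * s) * indicator ?D \<zeta>" for \<zeta>
    by (simp add: U_def indicator_def)
  have iU: "integrable lborel (\<lambda>\<zeta>. indicator ?D \<zeta> *\<^sub>R U \<zeta>)"
    unfolding eqU by (intro Bochner_Integration.integrable_diff integrable_divide_zero Bochner_Integration.integrable_sum li iD) auto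
  have mean: "(\<Sum>j<n. r) / real n = r" for r :: real using n by simp
  \<comment> \<open>The terms \<open>ln s\<close> cancel, so the lower bound \<open>c0\<close> for
    the mean is independent of the scale; it is positive exactly when
    \<open>\<beta> < exp (-1/2)\<close>.\<close>
  have "pi * s\<^sup>2 * c0 = (\<Sum>j<n. pi * s\<^sup>2 * (ln s - 1 / 2)) / real n - ln (\<beta> * s) * (pi * s\<^sup>2)"
    using s \<beta> by (simp only: mean) (simp add: c0(1) ln_mult algebra_simps)
  also have "\<dots> \<le> (\<Sum>j<n. \<integral>\<zeta>. indicator ?D \<zeta> *\<^sub>R ln (cmod (\<zeta> - x j)) \<partial>lborel) / real n - ln (\<beta> * s) * measure lborel ?D"
    unfolding mD by (intro diff_mono divide_right_mono sum_mono ge) auto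
  also have "\<dots> = (\<integral>\<zeta>. indicator ?D \<zeta> *\<^sub>R U \<zeta> \<partial>lborel)"
  proof -
    have "(\<integral>\<zeta>. indicator ?D \<zeta> *\<^sub>R U \<zeta> \<partial>lborel)
      = (\<integral>\<zeta>. (\<Sum>j<n. indicator ?D \<zeta> *\<^sub>R ln (cmod (\<zeta> - x j))) / real n \<partial>lborel) - (\<integral>\<zeta>. ln (\<beta> * s) * indicator ?D \<zeta> \<partial>lborel)"
      unfolding eqU
      by (intro Bochner_Integration.integral_diff integrable_divide_zero Bochner_Integration.integrable_sum li iD) auto
    then show ?thesis
      using Bochner_Integration.integral_sum[of "{..<n}" lborel "\<lambda>j \<zeta>. indicator ?D \<zeta> *\<^sub>R ln (cmod (\<zeta> - x j))"] li
      by simp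
  qed
  also have "\<dots> \<le> (\<integral>\<zeta>. c0 / 4 * indicator ?D \<zeta> + (M * indicator S \<zeta> + M * indicator (?D - ?D') \<zeta>) \<partial>lborel)"
  proof (rule integral_mono_AE)
    have SD: "S \<subseteq> ?D" using D'D by (auto simp: S_def)
    show "integrable lborel (\<lambda>\<zeta>. c0 / 4 * indicator ?D \<zeta> + (M * indicator S \<zeta> + M * indicator (?D - ?D') \<zeta>))"
      using SD by (intro Bochner_Integration.integrable_add iD) auto
    have "AE \<zeta> in lborel. \<forall>j<n. \<zeta> \<noteq> x j"
      using AE_lborel_singleton by (intro AE_all_countable[THEN iffD2] allI) auto
    then show "AE \<zeta> in lborel. indicator ?D \<zeta> *\<^sub>R U \<zeta> \<le> c0 / 4 * indicator ?D \<zeta> + (M * indicator S \<zeta> + M * indicator (?D - ?D') \<zeta>)"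
    proof eventually_elim
      case (elim \<zeta>)
      show ?case
      proof (cases "\<zeta> \<in> ?D")
        case True
        have "\<zeta> \<in> S \<or> \<zeta> \<in> ?D - ?D' \<or> (\<zeta> \<in> ?D' \<and> \<zeta> \<notin> S \<and> U \<zeta> \<le> c0 / 4)"
          using True elim by (force simp: S_def)
        then show ?thesis
          using SU[OF True elim] True M0 c0(2) by (auto simp: indicator_def split: if_splits)
      next
        case False
        then show ?thesis using M0 by simp
      qed
    qed
  qed (rule iU)
  also have "\<dots> = c0 / 4 * measure lborel ?D + (M * measure lborel S + M * measure lborel (?D - ?D'))"
  proof -
    have SD: "S \<subseteq> ?D" using D'D by (auto simp: S_def)
    have i: "integrable lborel (\<lambda>\<zeta>. c0 / 4 * indicator ?D \<zeta> :: real)"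
      "integrable lborel (\<lambda>\<zeta>. M * indicator S \<zeta> :: real)"
      "integrable lborel (\<lambda>\<zeta>. M * indicator (?D - ?D') \<zeta> :: real)"
      using SD by (intro iD; auto)+
    show ?thesis
      unfolding Bochner_Integration.integral_add[OF i(1) Bochner_Integration.integrable_add[OF i(2,3)]]
        Bochner_Integration.integral_add[OF i(2,3)] by simp
  qed
  also have "measure lborel (?D - ?D') = pi * s\<^sup>2 * (1 - (1 - \<delta>)\<^sup>2)"
  proof -
    have "measure lborel (?D - ?D') = measure lborel ?D - measure lborel ?D'"
      using D'D fin[of ?D] by (intro measure_Diff) auto
    also have "\<dots> = pi * s\<^sup>2 * (1 - (1 - \<delta>)\<^sup>2)"
      unfolding mD mD' by (simp add: power2_eq_square algebra_simps)
    finally show ?thesis .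
  qed
  \<comment> \<open>The annulus occupies at most the fraction \<open>2 * \<delta>\<close> of the
    disc; \<open>\<delta>\<close> was chosen so that \<open>2 * \<delta> * M\<close> equals
    \<open>c0 / 2\<close>.\<close>
  also have "M * (pi * s\<^sup>2 * (1 - (1 - \<delta>)\<^sup>2)) \<le> M * (pi * s\<^sup>2 * (2 * \<delta>))"
    using M0 s by (intro mult_left_mono) (auto simp: power2_eq_square algebra_simps)
  also have "M * (pi * s\<^sup>2 * (2 * \<delta>)) = pi * s\<^sup>2 * c0 / 2"
    using M0 by (simp add: \<delta>)
  finally have "pi * s\<^sup>2 * c0 \<le> c0 / 4 * (pi * s\<^sup>2) + (M * measure lborel S + pi * s\<^sup>2 * c0 / 2)"
    by (simp add: mD)
  then have "pi * s\<^sup>2 * c0 / 4 \<le> M * measure lborel S"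
    by (simp add: algebra_simps)
  then show "pi * s\<^sup>2 * c0 / (4 * M) \<le> measure lborel S"
    using M0 by (simp add: field_simps)
qed

section \<open>Rayleigh quotients and the eigenvalue bound\<close>

lemma lambda1_le_rayleigh:
  assumes "\<phi> \<in> test_functions \<Omega>" "\<phi> z \<noteq> 0"
  shows "lambda1 \<Omega> \<le> (\<integral>z. (dx \<phi> z)\<^sup>2 + (dy \<phi> z)\<^sup>2 \<partial>lborel) / (\<integral>z. (\<phi> z)\<^sup>2 \<partial>lborel)"
  unfolding lambda1_def
proof (rule cInf_lower)
  show "bdd_below {(\<integral>z. (dx \<phi> z)\<^sup>2 + (dy \<phi> z)\<^sup>2 \<partial>lborel) / (\<integral>z. (\<phi> z)\<^sup>2 \<partial>lborel)
                     | \<phi>. \<phi> \<in> test_functions \<Omega> \<and> (\<exists>z. \<phi> z \<noteq> 0)}"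
    by (rule bdd_belowI[of _ 0]) (auto intro!: divide_nonneg_nonneg Bochner_Integration.integral_nonneg)
qed (use assms in blast)

text \<open>The Dirichlet integral is at most \<open>16 * pi\<close>, and the square integral at
  least \<open>m\<close> times the area of \<open>S\<close>. Dividing gives \<open>C / s ^ 2\<close>
  with a constant made of \<open>m\<close>, \<open>c0\<close> and \<open>M\<close> alone, hence
  depending only on \<open>\<beta>\<close>.\<close>

lemma lambda1_bound_of_capacity:
  assumes \<beta>: "0 < \<beta>" "\<beta> < exp (- 1 / 2)"
  obtains C where "0 < C"
    "\<And>\<Omega> z s. open \<Omega> \<Longrightarrow> 0 < s \<Longrightarrow> log_capacity (cball z s - \<Omega>) < \<beta> * s \<Longrightarrow> lambda1 \<Omega> \<le> C / s\<^sup>2"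
proof -
  define c0 where "c0 = - ln \<beta> - 1 / 2"
  define M where "M = ln 2 - ln \<beta>"
  define \<delta> where "\<delta> = c0 / (4 * M)"
  \<comment> \<open>Lower bound for the squared test function on \<open>S\<close>: the first factor
    is the cut-off at radius \<open>(1 - \<delta>) * s\<close>, the second the value of
    \<open>v\<close> at potential \<open>c0 / 4\<close>.\<close>
  define m where "m = (flat_exp 0 (1 - (1 - \<delta>)\<^sup>2) * flat_exp 0 (c0 / 4 / (2 * M)))\<^sup>2"
  define C where "C = 64 * M / (m * c0)"
  have "ln \<beta> < ln (exp (- 1 / 2))" using \<beta> by (subst ln_less_cancel_iff) auto
  then have c0: "0 < c0" by (simp add: c0_def)
  have "(0::real) < ln 2" by simp
  then have Mc: "c0 < M" unfolding c0_def M_def by linarith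
  then have M0: "0 < M" using c0 by simp
  have \<delta>0: "0 < \<delta>" "\<delta> < 1" using M0 c0 Mc by (auto simp: \<delta>_def field_simps)
  have "0 < 1 - (1 - \<delta>)\<^sup>2"
    using \<delta>0 by (simp add: power2_eq_square algebra_simps)
  moreover have "0 < c0 / 4 / (2 * M)" using c0 M0 by simp
  moreover have "0 < flat_exp 0 u" if "0 < u" for u using that by (simp add: flat_exp_def)
  ultimately have m: "0 < m" unfolding m_def by (intro zero_less_power mult_pos_pos) auto
  have "0 < C" using m c0 M0 by (simp add: C_def)
  moreover have "lambda1 \<Omega> \<le> C / s\<^sup>2"
    if \<Omega>: "open \<Omega>" and s: "0 < s" and cap: "log_capacity (cball z s - \<Omega>) < \<beta> * s" for \<Omega> z s
  proof -
    let ?D = "cball z s"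
    have "compact (?D - \<Omega>)" using \<Omega> by (intro compact_diff) auto
    then obtain n x where n: "0 < (n::nat)" and x: "\<And>j. x j \<in> ?D"
      and small: "\<And>\<zeta>. \<zeta> \<in> ?D - \<Omega> \<Longrightarrow> (\<Prod>j<n. cmod (\<zeta> - x j)) < (\<beta> * s) ^ n"
      using exists_small_monic_polynomial[of "?D - \<Omega>" ?D, OF _ _ _ cap] s by (metis Diff_subset cball_eq_empty not_less_iff_gr_or_eq)
    define A where "A \<zeta> = (\<Prod>j<n. (cmod (\<zeta> - x j))\<^sup>2)" for \<zeta>
    \<comment> \<open>Off the zeros, \<open>a * ln (A \<zeta>) - c = U \<zeta> / (2 * M)\<close>;
      the extra 2 next to \<open>n\<close> is there because \<open>A\<close> is a product of
      squares. As \<open>U\<close> is at most \<open>M\<close> on the disc, the argument stays in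
      the range up to 1/2 where \<open>exp (-1/y)\<close> is convex.\<close>
    define a where "a = 1 / (2 * real n) / (2 * M)"
    define c where "c = ln (\<beta> * s) / (2 * M)"
    define U where "U \<zeta> = (\<Sum>j<n. ln (cmod (\<zeta> - x j))) / real n - ln (\<beta> * s)" for \<zeta>
    define S where "S = {\<zeta> \<in> cball z ((1 - \<delta>) * s). c0 / 4 \<le> U \<zeta> \<and> (\<forall>j<n. \<zeta> \<noteq> x j)}"
    define v where "v = (\<lambda>\<zeta>. flat_log a c 0 0 (A \<zeta>))"
    define \<eta> where "\<eta> = (\<lambda>\<zeta>. flat_exp 0 (1 - (cmod (\<zeta> - z))\<^sup>2 / s\<^sup>2))"
    define \<phi> where "\<phi> = (\<lambda>\<zeta>. \<eta> \<zeta> * v \<zeta>)"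
    note region = large_potential_region[where x = x and z = z, OF s n x \<beta>(1) c0_def c0 M_def \<delta>_def, folded U_def, folded S_def]
    have a0: "0 < a" using n M0 by (simp add: a_def)
    have lhA: "log_harmonic A" unfolding A_def by (rule log_harmonic_prod)
    then have smA: "smooth_fun A" by (simp add: log_harmonic_def)
    have smv: "smooth_fun v" unfolding v_def by (rule smooth_fun_comp[OF real_smooth_flat_log[OF a0] smA])
    have cut: "smooth_fun \<eta>" "\<And>\<zeta>. \<zeta> \<notin> ?D \<Longrightarrow> \<eta> \<zeta> = 0"
      "\<And>\<zeta>. (dx \<eta> \<zeta>)\<^sup>2 + (dy \<eta> \<zeta>)\<^sup>2 \<le> 16 / s\<^sup>2 * indicator ?D \<zeta>"
      unfolding \<eta>_def by (fact disc_cutoff[OF s])+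
    have sm\<phi>: "smooth_fun \<phi>" unfolding \<phi>_def by (rule smooth_fun_mult[OF cut(1) smv])
    have A0: "0 \<le> A \<zeta>" for \<zeta> by (simp add: A_def prod_nonneg)
    have Apos: "0 < A \<zeta> \<longleftrightarrow> (\<forall>j<n. \<zeta> \<noteq> x j)" for \<zeta>
      using A0[of \<zeta>] by (auto simp: A_def less_le)
    have lnA: "a * ln (A \<zeta>) - c = U \<zeta> / (2 * M)" if "\<forall>j<n. \<zeta> \<noteq> x j" for \<zeta>
    proof -
      have "ln (A \<zeta>) = (\<Sum>j<n. ln ((cmod (\<zeta> - x j))\<^sup>2))"
        unfolding A_def using that by (intro ln_prod) auto
      also have "\<dots> = 2 * (\<Sum>j<n. ln (cmod (\<zeta> - x j)))"
        using that by (simp add: ln_realpow sum_distrib_left)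
      finally show ?thesis using n M0 by (simp add: a_def c_def U_def field_simps)
    qed
    have v_eq: "v \<zeta> = (if \<forall>j<n. \<zeta> \<noteq> x j then flat_exp 0 (U \<zeta> / (2 * M)) else 0)" for \<zeta>
      using lnA[of \<zeta>] Apos[of \<zeta>] by (auto simp: v_def flat_log_def not_le)
    have v01: "0 \<le> v \<zeta>" "v \<zeta> \<le> 1" for \<zeta>
      unfolding v_eq by (auto simp: flat_exp_nonneg flat_exp_0_le_1)
    have sub: "0 \<le> v \<zeta> * (dx (dx v) \<zeta> + dy (dy v) \<zeta>)" if "\<zeta> \<in> ?D" for \<zeta>
    proof (cases "\<forall>j<n. \<zeta> \<noteq> x j")
      case True
      have "a * ln (A \<zeta>) - c \<le> 1 / 2"
        unfolding lnA[OF True] using region(3)[OF that True] M0 by (simp add: divide_le_eq)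
      then show ?thesis unfolding v_def by (rule flat_log_subharmonic[OF lhA a0])
    next
      case False
      then have "v \<zeta> = 0" by (auto simp: v_eq)
      then show ?thesis by simp
    qed
    have "(\<integral>\<zeta>. (dx \<phi> \<zeta>)\<^sup>2 + (dy \<phi> \<zeta>)\<^sup>2 \<partial>lborel) \<le> (\<integral>\<zeta>. (v \<zeta>)\<^sup>2 * ((dx \<eta> \<zeta>)\<^sup>2 + (dy \<eta> \<zeta>)\<^sup>2) \<partial>lborel)"
      unfolding \<phi>_def by (rule caccioppoli_inequality[OF cut(1) smv compact_cball cut(2) sub])
    also have "\<dots> \<le> (\<integral>\<zeta>. 16 / s\<^sup>2 * indicator ?D \<zeta> \<partial>lborel)"
    proof (rule integral_mono)
      have off: "dx \<eta> \<zeta> = 0" "dy \<eta> \<zeta> = 0" if "\<zeta> \<notin> ?D" for \<zeta>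
        using dx_outside_support[OF closed_cball cut(2) that] dy_outside_support[OF closed_cball cut(2) that] by auto
      show "integrable lborel (\<lambda>\<zeta>. (v \<zeta>)\<^sup>2 * ((dx \<eta> \<zeta>)\<^sup>2 + (dy \<eta> \<zeta>)\<^sup>2))"
        using off
        by (intro integrable_continuous_compact_support[where S = ?D] smooth_fun_continuous smooth_fun_mult
            smooth_fun_add smooth_fun_power smv smooth_fun_dx smooth_fun_dy cut(1)) auto
      show "integrable lborel (\<lambda>\<zeta>. 16 / s\<^sup>2 * indicator ?D \<zeta> :: real)"
        using emeasure_lborel_cball_finite[of z s]
        by (intro integrable_mult_right integrable_real_indicator) auto
      show "(v \<zeta>)\<^sup>2 * ((dx \<eta> \<zeta>)\<^sup>2 + (dy \<eta> \<zeta>)\<^sup>2) \<le> 16 / s\<^sup>2 * indicator ?D \<zeta>" for \<zeta>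
      proof -
        have "(v \<zeta>)\<^sup>2 \<le> 1" using v01[of \<zeta>] by (simp add: power_le_one)
        then have "(v \<zeta>)\<^sup>2 * ((dx \<eta> \<zeta>)\<^sup>2 + (dy \<eta> \<zeta>)\<^sup>2) \<le> 1 * ((dx \<eta> \<zeta>)\<^sup>2 + (dy \<eta> \<zeta>)\<^sup>2)"
          by (intro mult_right_mono) auto
        then show ?thesis using cut(3)[of \<zeta>] by simp
      qed
    qed
    also have "\<dots> = 16 * pi"
      using s by (simp add: measure_cball_complex)
    finally have num: "(\<integral>\<zeta>. (dx \<phi> \<zeta>)\<^sup>2 + (dy \<phi> \<zeta>)\<^sup>2 \<partial>lborel) \<le> 16 * pi" .
    have S\<phi>: "m \<le> (\<phi> \<zeta>)\<^sup>2" if "\<zeta> \<in> S" for \<zeta>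
    proof -
      have \<zeta>: "cmod (\<zeta> - z) \<le> (1 - \<delta>) * s" "c0 / 4 \<le> U \<zeta>" "\<forall>j<n. \<zeta> \<noteq> x j"
        using that by (auto simp: S_def dist_norm norm_minus_commute)
      have "(cmod (\<zeta> - z))\<^sup>2 \<le> ((1 - \<delta>) * s)\<^sup>2" using \<zeta>(1) by (intro power_mono) auto
      then have "1 - (1 - \<delta>)\<^sup>2 \<le> 1 - (cmod (\<zeta> - z))\<^sup>2 / s\<^sup>2"
        using s by (simp add: divide_le_eq power_mult_distrib)
      then have "flat_exp 0 (1 - (1 - \<delta>)\<^sup>2) \<le> \<eta> \<zeta>" unfolding \<eta>_def by (rule flat_exp_0_mono)
      moreover have "c0 / 4 / (2 * M) \<le> U \<zeta> / (2 * M)" using \<zeta>(2) M0 by (intro divide_right_mono) auto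
      then have "flat_exp 0 (c0 / 4 / (2 * M)) \<le> v \<zeta>" using \<zeta>(3) flat_exp_0_mono by (simp add: v_eq)
      ultimately show ?thesis
        unfolding m_def \<phi>_def by (intro power_mono mult_mono) (auto simp: flat_exp_nonneg \<eta>_def)
    qed
    have "m * (pi * s\<^sup>2 * c0 / (4 * M)) \<le> m * measure lborel S"
      using region(2) m by (intro mult_left_mono) auto
    also have "\<dots> = (\<integral>\<zeta>. m * indicator S \<zeta> \<partial>lborel)"
      using region(1) by simp
    also have "\<dots> \<le> (\<integral>\<zeta>. (\<phi> \<zeta>)\<^sup>2 \<partial>lborel)"
    proof (rule integral_mono)
      have "S \<subseteq> ?D"
      proof -
        have "(1 - \<delta>) * s \<le> s" using s \<delta>0 by (simp add: algebra_simps)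
        then show ?thesis by (auto simp: S_def)
      qed
      then have "emeasure lborel S < \<infinity>"
        using emeasure_mono[of S ?D lborel] emeasure_lborel_cball_finite[of z s] by (auto intro: le_less_trans)
      then show "integrable lborel (\<lambda>\<zeta>. m * indicator S \<zeta> :: real)"
        using region(1) by (intro integrable_mult_right integrable_real_indicator) auto
      show "integrable lborel (\<lambda>\<zeta>. (\<phi> \<zeta>)\<^sup>2)"
        using cut(2) by (intro integrable_continuous_compact_support[where S = ?D] smooth_fun_continuous
            smooth_fun_power sm\<phi>) (auto simp: \<phi>_def)
      show "m * indicator S \<zeta> \<le> (\<phi> \<zeta>)\<^sup>2" for \<zeta>
        using S\<phi>[of \<zeta>] by (cases "\<zeta> \<in> S") auto
    qed
    finally have den: "m * (pi * s\<^sup>2 * c0 / (4 * M)) \<le> (\<integral>\<zeta>. (\<phi> \<zeta>)\<^sup>2 \<partial>lborel)" .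
    have dpos: "0 < m * (pi * s\<^sup>2 * c0 / (4 * M))" using m s c0 M0 by simp
    have "\<exists>\<zeta>. \<phi> \<zeta> \<noteq> 0"
    proof (rule ccontr)
      assume "\<not> ?thesis"
      then have "(\<integral>\<zeta>. (\<phi> \<zeta>)\<^sup>2 \<partial>lborel) = 0" by simp
      with den dpos show False by simp
    qed
    then obtain \<zeta>0 where "\<phi> \<zeta>0 \<noteq> 0" by blast
    have "\<phi> \<in> test_functions \<Omega>"
    proof -
      \<comment> \<open>\<open>v\<close> is nonzero only where the polynomial exceeds
        \<open>(\<beta> * s) ^ n\<close> in modulus. The weak inequality makes the set closed, so it
        contains the support; the strict inequality in \<open>small\<close> still keeps it inside
        \<open>\<Omega>\<close>.\<close>
      let ?F = "?D \<inter> {\<zeta>. ((\<beta> * s) ^ n)\<^sup>2 \<le> A \<zeta>}"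
      have "closed {\<zeta>. ((\<beta> * s) ^ n)\<^sup>2 \<le> A \<zeta>}"
        by (intro closed_Collect_le continuous_on_const smooth_fun_continuous smA)
      then have comp: "compact ?F" by (intro compact_Int_closed) auto
      have "\<zeta> \<in> ?F" if "\<phi> \<zeta> \<noteq> 0" for \<zeta>
      proof -
        have "\<eta> \<zeta> \<noteq> 0" "v \<zeta> \<noteq> 0" using that by (auto simp: \<phi>_def)
        then have "\<zeta> \<in> ?D" using cut(2) by blast
        have "0 < A \<zeta>" "0 < a * ln (A \<zeta>) - c"
          using \<open>v \<zeta> \<noteq> 0\<close> by (auto simp: v_def flat_log_def flat_exp_def split: if_splits)
        then have "2 * real n * ln (\<beta> * s) < ln (A \<zeta>)"
          using n M0 by (simp add: a_def c_def field_simps)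
        moreover have "2 * real n * ln (\<beta> * s) = ln (((\<beta> * s) ^ n)\<^sup>2)"
          using \<beta> s by (simp add: ln_realpow)
        ultimately have "((\<beta> * s) ^ n)\<^sup>2 < A \<zeta>"
          using \<open>0 < A \<zeta>\<close> \<beta> s by (subst ln_less_cancel_iff[symmetric]) auto
        then show ?thesis using \<open>\<zeta> \<in> ?D\<close> by simp
      qed
      then have sub: "tsupport \<phi> \<subseteq> ?F"
        unfolding tsupport_def using compact_imp_closed[OF comp] by (intro closure_minimal) auto
      have "?F \<subseteq> \<Omega>"
      proof (rule subsetI, rule ccontr)
        fix \<zeta> assume \<zeta>: "\<zeta> \<in> ?F" "\<zeta> \<notin> \<Omega>"
        then have "(\<Prod>j<n. cmod (\<zeta> - x j)) < (\<beta> * s) ^ n" by (intro small) auto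
        then have "(\<Prod>j<n. cmod (\<zeta> - x j))\<^sup>2 < ((\<beta> * s) ^ n)\<^sup>2"
          by (intro power_strict_mono prod_nonneg) auto
        then show False using \<zeta> by (simp add: A_def prod_power_distrib)
      qed
      moreover have "compact (?F \<inter> tsupport \<phi>)"
        using comp by (rule compact_Int_closed) (simp add: tsupport_def)
      then have "compact (tsupport \<phi>)" using sub by (simp only: Int_absorb1)
      ultimately show ?thesis
        using sub sm\<phi> unfolding test_functions_def by blast
    qed
    from lambda1_le_rayleigh[OF this \<open>\<phi> \<zeta>0 \<noteq> 0\<close>]
    have "lambda1 \<Omega> \<le> (\<integral>\<zeta>. (dx \<phi> \<zeta>)\<^sup>2 + (dy \<phi> \<zeta>)\<^sup>2 \<partial>lborel) / (\<integral>\<zeta>. (\<phi> \<zeta>)\<^sup>2 \<partial>lborel)" .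
    also have "\<dots> \<le> 16 * pi / (m * (pi * s\<^sup>2 * c0 / (4 * M)))"
      using num den dpos by (intro frac_le) auto
    also have "\<dots> = C / s\<^sup>2"
      using m c0 M0 s by (simp add: C_def field_simps)
    finally show ?thesis .
  qed
  ultimately show ?thesis using that by blast
qed

text \<open>Small discs about a point of \<open>\<Omega>\<close> leave an empty difference, whose
  capacity is 0 because the infimum over no measures is infinite. Positivity lets the inradius be
  inverted as an ordinary real once it is known to be finite.\<close>

lemma cap_inradius_pos:
  assumes "open \<Omega>" "\<Omega> \<noteq> {}" "0 < \<alpha>"
  shows "0 < cap_inradius \<alpha> \<Omega>"
proof -
  obtain z where z: "z \<in> \<Omega>" using assms by blast
  then obtain r where r: "r > 0" "ball z r \<subseteq> \<Omega>"
    using assms(1) open_contains_ball by blast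
  have empty: "log_capacity {} = 0"
    by (simp add: log_capacity_def robin_const_def top_ereal_def)
  have "log_capacity (cball z s - \<Omega>) \<le> \<alpha> * s" if "0 < s" "s < r" for s
  proof -
    have eq: "cball z s - \<Omega> = {}" using r(2) that(2) by (auto simp: subset_eq)
    show ?thesis unfolding eq empty using that assms(3) by simp
  qed
  then have "ereal r \<le> cap_inradius \<alpha> \<Omega>"
    unfolding cap_inradius_def using r(1) z by (intro Sup_upper) blast
  then show ?thesis using r(1) by (metis ereal_less(2) less_le_trans)
qed

theorem theorem7p1:
  fixes \<alpha> :: real
  assumes "0 < \<alpha>" and "\<alpha> < exp (- 1 / 2)"
  shows "\<exists>C>0. \<forall>\<Omega> :: complex set. open \<Omega> \<and> connected \<Omega> \<and> \<Omega> \<noteq> {} \<and> \<Omega> \<noteq> UNIV \<longrightarrow>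
           ereal (lambda1 \<Omega>) \<le> ereal C * (inverse (cap_inradius \<alpha> \<Omega>))\<^sup>2"
proof -
  \<comment> \<open>The gap between \<open>\<alpha>\<close> and \<open>\<beta>\<close> turns the
    weak capacity bound of \<open>cap_inradius\<close> into the strict one required by the
    polynomial construction.\<close>
  obtain \<beta> where \<beta>: "\<alpha> < \<beta>" "\<beta> < exp (- 1 / 2)" using dense[OF assms(2)] by blast
  have "0 < \<beta>" using \<beta> assms by simp
  then obtain C where C: "0 < C"
    and bound: "\<And>\<Omega> z s. open \<Omega> \<Longrightarrow> 0 < s \<Longrightarrow> log_capacity (cball z s - \<Omega>) < \<beta> * s \<Longrightarrow> lambda1 \<Omega> \<le> C / s\<^sup>2"
    using lambda1_bound_of_capacity[OF _ \<beta>(2)] by blast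
  have "ereal (lambda1 \<Omega>) \<le> ereal C * (inverse (cap_inradius \<alpha> \<Omega>))\<^sup>2"
    if \<Omega>: "open \<Omega>" "\<Omega> \<noteq> {}" for \<Omega> :: "complex set"
  \<comment> \<open>A nonpositive eigenvalue is trivially bounded by the nonnegative right side. An
    infinite inradius can occur only here, since the other case bounds the inradius by
    \<open>\<rho>\<close>.\<close>
  proof (cases "lambda1 \<Omega> \<le> 0")
    case True
    have "0 \<le> (inverse (cap_inradius \<alpha> \<Omega>))\<^sup>2"
      by (cases "inverse (cap_inradius \<alpha> \<Omega>)") (auto simp: power2_eq_square)
    then have "0 \<le> ereal C * (inverse (cap_inradius \<alpha> \<Omega>))\<^sup>2"
      using C by (intro ereal_0_le_mult) auto
    moreover have "ereal (lambda1 \<Omega>) \<le> 0" using True by simp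
    ultimately show ?thesis by (rule order_trans[rotated])
  next
    case False
    define \<rho> where "\<rho> = sqrt (C / lambda1 \<Omega>)"
    have \<rho>: "0 < \<rho>" using False C by (simp add: \<rho>_def)
    have "cap_inradius \<alpha> \<Omega> \<le> ereal \<rho>"
      unfolding cap_inradius_def
    proof (rule Sup_least, clarify)
      fix r z assume r: "0 < r" and z: "z \<in> \<Omega>"
        and cap: "\<forall>s. 0 < s \<and> s < r \<longrightarrow> log_capacity (cball z s - \<Omega>) \<le> \<alpha> * s"
      have "s \<le> \<rho>" if s: "0 < s" "s < r" for s
      proof -
        have "log_capacity (cball z s - \<Omega>) \<le> \<alpha> * s" using cap s by blast
        also have "\<dots> < \<beta> * s" using \<beta> s by simp
        finally have "lambda1 \<Omega> \<le> C / s\<^sup>2" by (rule bound[OF \<Omega>(1) s(1)])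
        then have "s\<^sup>2 \<le> C / lambda1 \<Omega>" using False s by (simp add: field_simps)
        then show ?thesis unfolding \<rho>_def by (rule real_le_rsqrt)
      qed
      \<comment> \<open>The capacity condition is available only for \<open>s\<close> strictly below
        \<open>r\<close>, so \<open>r\<close> itself is reached by density.\<close>
      then have "r \<le> \<rho>" using r by (intro dense_le_bounded[of 0 r])
      then show "ereal r \<le> ereal \<rho>" by simp
    qed
    moreover have "0 < cap_inradius \<alpha> \<Omega>" using cap_inradius_pos[OF \<Omega> assms(1)] .
    ultimately obtain q where q: "cap_inradius \<alpha> \<Omega> = ereal q" "0 < q" "q \<le> \<rho>"
      by (cases "cap_inradius \<alpha> \<Omega>") auto
    have "q\<^sup>2 \<le> \<rho>\<^sup>2" using q by (intro power_mono) auto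
    also have "\<rho>\<^sup>2 = C / lambda1 \<Omega>" using False C by (simp add: \<rho>_def)
    finally have "lambda1 \<Omega> \<le> C * (inverse q)\<^sup>2"
      using False q by (simp add: field_simps)
    then show ?thesis using q by (simp add: power2_eq_square)
  qed
  then show ?thesis using C by blast
qed

end
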